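(* Let $p>1$ and let $M^3$ be a $3$-dimensional CR submanifold of maximal CR dimension of $\mathbf{P}^{\frac{3+p}{2}}(\mathbf{C})$. If the normal connection of $M^3$ is flat, then $p=3$ and the distinguished normal vector $\xi$ is umbilical (at every point of $M^3$).
   Context: All manifolds are smooth and nonempty. $\mathbf{P}^{\frac{3+p}{2}}(\mathbf{C})$ is the complex projective space of complex dimension $\frac{3+p}{2}$ with the Fubini–Study metric $\langle\cdot,\cdot\rangle$ of constant holomorphic sectional curvature $4$ and complex structure $J$. For a $3$-dimensional real submanifold $M^3$ (so of real codimension $p$) and $x\in M^3$, the holomorphic tangent space is $H_x(M^3)=JT_x(M^3)\cap T_x(M^3)$. $M^3$ is a CR submanifold of maximal CR dimension if $\dim_{\mathbf{R}}H_x(M^3)=2$ for every $x\in M^3$. Then at each $x$ there is a unit normal vector $\xi_x$, unique up to sign, with $JT_x(M^3)\subset T_x(M^3)\oplus\mathrm{span}\{\xi_x\}$; it is called the distinguished normal vector. The normal connection is flat if its curvature tensor $R^{\perp}$ vanishes. A normal vector $\eta$ at $x$ is umbilical if the shape operator $A_\eta$ with respect to $\eta$ equals $\langle\eta,\zeta\rangle\,\mathrm{id}$ on $T_x(M^3)$, where $\zeta$ is the mean curvature vector ($\frac13$ times the trace of the second fundamental form). *)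

theory Defs
  imports "HOL-Analysis.Analysis"
begin

section \<open>Smooth maps and smooth manifolds\<close>

text \<open>Continuous differentiability of order \<open>k\<close>, and smoothness, on an open subset of a Euclidean space.\<close>

primrec cont_diff :: "nat \<Rightarrow> ('a::euclidean_space \<Rightarrow> 'b::euclidean_space) \<Rightarrow> 'a set \<Rightarrow> bool" where
  "cont_diff 0 f S \<longleftrightarrow> continuous_on S f"
| "cont_diff (Suc k) f S \<longleftrightarrow> (\<forall>x\<in>S. f differentiable (at x)) \<and>
     (\<forall>v. cont_diff k (\<lambda>x. frechet_derivative f (at x) v) S)"

definition smooth_on :: "('a::euclidean_space \<Rightarrow> 'b::euclidean_space) \<Rightarrow> 'a set \<Rightarrow> bool" where
  "smooth_on f S \<longleftrightarrow> (\<forall>k. cont_diff k f S)"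

text \<open>A chart is a pair of its domain and its coordinate map. A manifold is given by its atlas, which
  determines the underlying set and the topology.\<close>

type_synonym ('m, 'e) chart = "'m set \<times> ('m \<Rightarrow> 'e)"

definition carrier :: "('m, 'e) chart set \<Rightarrow> 'm set" where
  "carrier A = (\<Union>c\<in>A. fst c)"

definition coord_dom :: "('m, 'e) chart \<Rightarrow> ('l, 'f) chart \<Rightarrow> ('m \<Rightarrow> 'l) \<Rightarrow> 'e set" where
  "coord_dom c d f = snd c ` {x \<in> fst c. f x \<in> fst d}"

definition coord_rep :: "('m, 'e) chart \<Rightarrow> ('l, 'f) chart \<Rightarrow> ('m \<Rightarrow> 'l) \<Rightarrow> 'e \<Rightarrow> 'f" where
  "coord_rep c d f = (\<lambda>u. snd d (f (inv_into (fst c) (snd c) u)))"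

definition smooth_atlas :: "('m, 'e::euclidean_space) chart set \<Rightarrow> bool" where
  "smooth_atlas A \<longleftrightarrow>
     (\<forall>c\<in>A. inj_on (snd c) (fst c) \<and> open (snd c ` fst c)) \<and>
     (\<forall>c\<in>A. \<forall>d\<in>A. open (coord_dom c d id) \<and> smooth_on (coord_rep c d id) (coord_dom c d id))"

definition manifold_topology :: "('m, 'e::euclidean_space) chart set \<Rightarrow> 'm topology" where
  "manifold_topology A =
     topology (\<lambda>S. S \<subseteq> carrier A \<and> (\<forall>c\<in>A. open (snd c ` (S \<inter> fst c))))"

lemma openin_manifold_topology:
  assumes "smooth_atlas A"
  shows "openin (manifold_topology A) S \<longleftrightarrow>
    S \<subseteq> carrier A \<and> (\<forall>c\<in>A. open (snd c ` (S \<inter> fst c)))"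
proof -
  have "istopology (\<lambda>S. S \<subseteq> carrier A \<and> (\<forall>c\<in>A. open (snd c ` (S \<inter> fst c))))"
    unfolding istopology_def
  proof (intro conjI allI impI ballI; (elim conjE)?)
    fix S T c
    assume S: "\<forall>c\<in>A. open (snd c ` (S \<inter> fst c))" and T: "\<forall>c\<in>A. open (snd c ` (T \<inter> fst c))"
      and c: "c \<in> A"
    have "inj_on (snd c) (fst c)"
      using assms c by (auto simp: smooth_atlas_def)
    then have "snd c ` (S \<inter> T \<inter> fst c) = snd c ` (S \<inter> fst c) \<inter> snd c ` (T \<inter> fst c)"
      by (auto simp: inj_on_def)
    then show "open (snd c ` (S \<inter> T \<inter> fst c))"
      using S T c by auto
  next
    fix \<K> c
    assume K: "\<forall>K\<in>\<K>. K \<subseteq> carrier A \<and> (\<forall>c\<in>A. open (snd c ` (K \<inter> fst c)))" and c: "c \<in> A"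
    have "snd c ` (\<Union>\<K> \<inter> fst c) = (\<Union>K\<in>\<K>. snd c ` (K \<inter> fst c))"
      by auto
    then show "open (snd c ` (\<Union>\<K> \<inter> fst c))"
      using K c by auto
  qed auto
  then show ?thesis
    by (simp add: manifold_topology_def)
qed

definition smooth_manifold :: "('m, 'e::euclidean_space) chart set \<Rightarrow> bool" where
  "smooth_manifold A \<longleftrightarrow> smooth_atlas A \<and> Hausdorff_space (manifold_topology A) \<and>
     second_countable (manifold_topology A)"

definition smooth_map ::
    "('m, 'e::euclidean_space) chart set \<Rightarrow> ('l, 'f::euclidean_space) chart set \<Rightarrow> ('m \<Rightarrow> 'l) \<Rightarrow> bool" where
  "smooth_map A B f \<longleftrightarrow> f ` carrier A \<subseteq> carrier B \<and>
     (\<forall>c\<in>A. \<forall>d\<in>B. open (coord_dom c d f) \<and> smooth_on (coord_rep c d f) (coord_dom c d f))"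

definition immersion ::
    "('m, 'e::euclidean_space) chart set \<Rightarrow> ('l, 'f::euclidean_space) chart set \<Rightarrow> ('m \<Rightarrow> 'l) \<Rightarrow> bool" where
  "immersion A B f \<longleftrightarrow> smooth_map A B f \<and>
     (\<forall>c\<in>A. \<forall>d\<in>B. \<forall>u\<in>coord_dom c d f. inj (frechet_derivative (coord_rep c d f) (at u)))"


section \<open>Immersed submanifolds of a Riemannian manifold, in coordinates\<close>

text \<open>Below, \<open>g\<close> is the coordinate expression of a Riemannian metric in a chart of the ambient
  manifold (\<open>g y\<close> is the inner product at the point with coordinates \<open>y\<close>), and \<open>F\<close> is the coordinate
  expression of an immersion. Tangent vectors of the submanifold at \<open>u\<close> are written as vectors \<open>a\<close> of
  the coordinate space; the corresponding ambient vector is the value at \<open>a\<close> of the derivative of \<open>F\<close>.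
  Vector fields of the ambient manifold along \<open>F\<close> are functions of \<open>u\<close>.\<close>

definition tangent_space :: "('a::euclidean_space \<Rightarrow> 'e::euclidean_space) \<Rightarrow> 'a \<Rightarrow> 'e set" where
  "tangent_space F u = range (frechet_derivative F (at u))"

definition normal_space ::
    "('e \<Rightarrow> 'e \<Rightarrow> 'e \<Rightarrow> real) \<Rightarrow> ('a::euclidean_space \<Rightarrow> 'e::euclidean_space) \<Rightarrow> 'a \<Rightarrow> 'e set" where
  "normal_space g F u = {v. \<forall>t\<in>tangent_space F u. g (F u) v t = 0}"

definition normal_part ::
    "('e \<Rightarrow> 'e \<Rightarrow> 'e \<Rightarrow> real) \<Rightarrow> ('a::euclidean_space \<Rightarrow> 'e::euclidean_space) \<Rightarrow> 'a \<Rightarrow> 'e \<Rightarrow> 'e" where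
  "normal_part g F u v = (THE n. n \<in> normal_space g F u \<and> v - n \<in> tangent_space F u)"

text \<open>The Christoffel symbols of the Levi-Civita connection: Koszul's formula for constant
  (hence commuting) coordinate fields.\<close>

definition christoffel ::
    "('e::euclidean_space \<Rightarrow> 'e \<Rightarrow> 'e \<Rightarrow> real) \<Rightarrow> 'e \<Rightarrow> 'e \<Rightarrow> 'e \<Rightarrow> 'e" where
  "christoffel g y v w = (THE z. \<forall>x. 2 * g y z x =
       frechet_derivative (\<lambda>q. g q w x) (at y) v
     + frechet_derivative (\<lambda>q. g q v x) (at y) w
     - frechet_derivative (\<lambda>q. g q v w) (at y) x)"

text \<open>The Levi-Civita derivative in direction \<open>a\<close> of a field \<open>V\<close> along \<open>F\<close>.\<close>

definition cov_deriv ::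
    "('e \<Rightarrow> 'e \<Rightarrow> 'e \<Rightarrow> real) \<Rightarrow> ('a::euclidean_space \<Rightarrow> 'e::euclidean_space) \<Rightarrow> ('a \<Rightarrow> 'e) \<Rightarrow> 'a \<Rightarrow> 'a \<Rightarrow> 'e" where
  "cov_deriv g F V u a = frechet_derivative V (at u) a
     + christoffel g (F u) (frechet_derivative F (at u) a) (V u)"

definition second_fundamental_form ::
    "('e \<Rightarrow> 'e \<Rightarrow> 'e \<Rightarrow> real) \<Rightarrow> ('a::euclidean_space \<Rightarrow> 'e::euclidean_space) \<Rightarrow> 'a \<Rightarrow> 'a \<Rightarrow> 'a \<Rightarrow> 'e" where
  "second_fundamental_form g F u a b =
     normal_part g F u (cov_deriv g F (\<lambda>q. frechet_derivative F (at q) b) u a)"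

definition shape_operator ::
    "('e \<Rightarrow> 'e \<Rightarrow> 'e \<Rightarrow> real) \<Rightarrow> ('a::euclidean_space \<Rightarrow> 'e::euclidean_space) \<Rightarrow> 'a \<Rightarrow> 'e \<Rightarrow> 'a \<Rightarrow> 'a" where
  "shape_operator g F u \<eta> a = (THE s. \<forall>b.
     g (F u) (frechet_derivative F (at u) s) (frechet_derivative F (at u) b) =
     g (F u) (second_fundamental_form g F u a b) \<eta>)"

definition gram_matrix ::
    "('e \<Rightarrow> 'e \<Rightarrow> 'e \<Rightarrow> real) \<Rightarrow> (real^'k \<Rightarrow> 'e::euclidean_space) \<Rightarrow> real^'k \<Rightarrow> real^'k^'k" where
  "gram_matrix g F u = (\<chi> i j. g (F u) (frechet_derivative F (at u) (axis i 1))
                                        (frechet_derivative F (at u) (axis j 1)))"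

text \<open>The trace of the second fundamental form is taken with respect to the induced metric.\<close>

definition mean_curvature_vector ::
    "('e \<Rightarrow> 'e \<Rightarrow> 'e \<Rightarrow> real) \<Rightarrow> (real^'k \<Rightarrow> 'e::euclidean_space) \<Rightarrow> real^'k \<Rightarrow> 'e" where
  "mean_curvature_vector g F u = (1 / real CARD('k)) *\<^sub>R
     (\<Sum>i\<in>UNIV. \<Sum>j\<in>UNIV. matrix_inv (gram_matrix g F u) $ i $ j *\<^sub>R
        second_fundamental_form g F u (axis i 1) (axis j 1))"

definition umbilical ::
    "('e \<Rightarrow> 'e \<Rightarrow> 'e \<Rightarrow> real) \<Rightarrow> (real^'k \<Rightarrow> 'e::euclidean_space) \<Rightarrow> real^'k \<Rightarrow> 'e \<Rightarrow> bool" where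
  "umbilical g F u \<eta> \<longleftrightarrow>
     (\<forall>a. shape_operator g F u \<eta> a = g (F u) \<eta> (mean_curvature_vector g F u) *\<^sub>R a)"

definition normal_connection ::
    "('e \<Rightarrow> 'e \<Rightarrow> 'e \<Rightarrow> real) \<Rightarrow> ('a::euclidean_space \<Rightarrow> 'e::euclidean_space) \<Rightarrow>
     ('a \<Rightarrow> 'a) \<Rightarrow> ('a \<Rightarrow> 'e) \<Rightarrow> 'a \<Rightarrow> 'e" where
  "normal_connection g F X \<eta> u = normal_part g F u (cov_deriv g F \<eta> u (X u))"

definition lie_bracket :: "('a::euclidean_space \<Rightarrow> 'a) \<Rightarrow> ('a \<Rightarrow> 'a) \<Rightarrow> 'a \<Rightarrow> 'a" where
  "lie_bracket X Y u = frechet_derivative Y (at u) (X u) - frechet_derivative X (at u) (Y u)"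

definition normal_curvature ::
    "('e \<Rightarrow> 'e \<Rightarrow> 'e \<Rightarrow> real) \<Rightarrow> ('a::euclidean_space \<Rightarrow> 'e::euclidean_space) \<Rightarrow>
     ('a \<Rightarrow> 'a) \<Rightarrow> ('a \<Rightarrow> 'a) \<Rightarrow> ('a \<Rightarrow> 'e) \<Rightarrow> 'a \<Rightarrow> 'e" where
  "normal_curvature g F X Y \<eta> u =
     normal_connection g F X (normal_connection g F Y \<eta>) u
   - normal_connection g F Y (normal_connection g F X \<eta>) u
   - normal_connection g F (lie_bracket X Y) \<eta> u"

text \<open>\<open>U\<close> is the domain of \<open>F\<close>; the condition ranges over all local vector fields and normal sections.\<close>

definition normal_flat ::
    "('e \<Rightarrow> 'e \<Rightarrow> 'e \<Rightarrow> real) \<Rightarrow> ('a::euclidean_space \<Rightarrow> 'e::euclidean_space) \<Rightarrow> 'a set \<Rightarrow> bool" where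
  "normal_flat g F U \<longleftrightarrow> (\<forall>W X Y \<eta>. open W \<and> W \<subseteq> U \<and>
     smooth_on X W \<and> smooth_on Y W \<and> smooth_on \<eta> W \<and> (\<forall>u\<in>W. \<eta> u \<in> normal_space g F u) \<longrightarrow>
     (\<forall>u\<in>W. normal_curvature g F X Y \<eta> u = 0))"


section \<open>Complex projective space\<close>

text \<open>The homogeneous coordinates of projective space of complex dimension \<open>CARD('n)\<close> are indexed by
  the type \<open>'n option\<close>, which has one element more than \<open>'n\<close>.\<close>

typedef (overloaded) 'n cproj =
  "{L. \<exists>z :: complex^('n::finite option). z \<noteq> 0 \<and> L = range (\<lambda>c. c *s z)}"
  morphisms line_of Abs_cproj
proof -
  have "(axis None 1 :: complex^('n option)) \<noteq> 0" by simp
  then show ?thesis by blast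
qed

text \<open>The homogeneous coordinates of the point with affine coordinates \<open>w\<close> in the \<open>i\<close>-th affine chart:
  the coordinate \<open>i\<close> is \<open>1\<close>, and the others are those of \<open>w\<close>, the one that would have index \<open>i\<close> being
  placed at \<open>None\<close> instead.\<close>

definition affine_lift :: "'n::finite option \<Rightarrow> complex^'n \<Rightarrow> complex^('n option)" where
  "affine_lift i w = (\<chi> j. case Transposition.transpose None i j of None \<Rightarrow> 1 | Some k \<Rightarrow> w $ k)"

definition affine_chart :: "'n::finite option \<Rightarrow> ('n cproj, complex^'n) chart" where
  "affine_chart i = ({L. \<exists>z\<in>line_of L. z $ i \<noteq> 0}, \<lambda>L. THE w. affine_lift i w \<in> line_of L)"

definition cproj_atlas :: "('n::finite cproj, complex^'n) chart set" where
  "cproj_atlas = range affine_chart"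

text \<open>The complex structure; the affine charts are holomorphic, so that it is multiplication by \<open>\<i>\<close> in
  each of them.\<close>

definition cplx_J :: "complex^'n \<Rightarrow> complex^'n" where
  "cplx_J v = \<i> *s v"

definition herm :: "complex^'n \<Rightarrow> complex^'n \<Rightarrow> complex" where
  "herm u v = (\<Sum>k\<in>UNIV. u $ k * cnj (v $ k))"

text \<open>The Fubini--Study metric of constant holomorphic sectional curvature 4: the metric for which the
  Hopf map from the unit sphere is a Riemannian submersion. First in homogeneous coordinates \<open>z\<close> (where
  \<open>u\<close>, \<open>v\<close> are any lifts of the tangent vectors), then in affine coordinates, where it has the
  same expression in every affine chart: see \<open>fubini_study_hom_invariant\<close> and
  \<open>fubini_study_affine\<close> below.\<close>

definition fubini_study_hom :: "complex^'n \<Rightarrow> complex^'n \<Rightarrow> complex^'n \<Rightarrow> real" where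
  "fubini_study_hom z u v = Re ((herm z z * herm u v - herm u z * herm z v) / (herm z z)\<^sup>2)"

definition fubini_study :: "complex^'n \<Rightarrow> complex^'n \<Rightarrow> complex^'n \<Rightarrow> real" where
  "fubini_study w u v = Re (((1 + herm w w) * herm u v - herm u w * herm w v) / (1 + herm w w)\<^sup>2)"

lemma herm_add_left: "herm (u + v) w = herm u w + herm v w"
  and herm_add_right: "herm w (u + v) = herm w u + herm w v"
  and herm_scale_left: "herm (c *s u) w = c * herm u w"
  and herm_scale_right: "herm u (c *s w) = cnj c * herm u w"
  by (simp_all add: herm_def sum.distrib sum_distrib_left algebra_simps)

lemma herm_self: "herm z z = complex_of_real ((norm z)\<^sup>2)"
proof -
  have "(norm z)\<^sup>2 = (\<Sum>k\<in>UNIV. (norm (z $ k))\<^sup>2)"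
    by (simp add: norm_vec_def L2_set_def sum_nonneg)
  then show ?thesis
    by (simp add: herm_def complex_norm_square del: of_real_power)
qed

lemma fubini_study_hom_invariant:
  assumes "c \<noteq> 0"
  shows "fubini_study_hom (c *s z) (c *s u + a *s z) (c *s v + b *s z) = fubini_study_hom z u v"
proof -
  have "herm (c *s z) (c *s z) * herm (c *s u + a *s z) (c *s v + b *s z)
        - herm (c *s u + a *s z) (c *s z) * herm (c *s z) (c *s v + b *s z)
      = (c * cnj c)\<^sup>2 * (herm z z * herm u v - herm u z * herm z v)"
    unfolding herm_add_left herm_add_right herm_scale_left herm_scale_right
    by (simp add: algebra_simps power2_eq_square)
  moreover have "(herm (c *s z) (c *s z))\<^sup>2 = (c * cnj c)\<^sup>2 * (herm z z)\<^sup>2"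
    by (simp add: herm_scale_left herm_scale_right power_mult_distrib)
  ultimately show ?thesis
    using assms by (simp add: fubini_study_hom_def)
qed

lemma herm_affine_lift:
  "herm (affine_lift i w) (affine_lift i w') = 1 + herm w w'"
proof -
  have "herm (affine_lift i w) (affine_lift i w') =
      (\<Sum>j\<in>UNIV. (case j of None \<Rightarrow> 1 | Some k \<Rightarrow> w $ k * cnj (w' $ k)))"
    unfolding herm_def affine_lift_def
    by (rule sum.reindex_bij_witness[of _ "Transposition.transpose None i" "Transposition.transpose None i"])
       (auto split: option.split)
  also have "\<dots> = 1 + herm w w'"
    by (simp add: UNIV_option_conv sum.reindex herm_def)
  finally show ?thesis .
qed

lemma fubini_study_affine:
  "fubini_study w u v = fubini_study_hom (affine_lift i w)
     (affine_lift i (w + u) - affine_lift i w) (affine_lift i (w + v) - affine_lift i w)"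
proof -
  have diff: "herm (x - y) z = herm x z - herm y z" "herm z (x - y) = herm z x - herm z y"
    for x y z :: "complex^'b"
    by (simp_all add: herm_def sum_subtractf algebra_simps)
  show ?thesis
    unfolding fubini_study_def fubini_study_hom_def diff herm_affine_lift
    by (simp add: herm_add_left herm_add_right)
qed


section \<open>CR submanifolds of maximal CR dimension\<close>

definition holomorphic_tangent_space ::
    "('a::euclidean_space \<Rightarrow> complex^'n) \<Rightarrow> 'a \<Rightarrow> (complex^'n) set" where
  "holomorphic_tangent_space F u = cplx_J ` tangent_space F u \<inter> tangent_space F u"

text \<open>For a 3-dimensional submanifold, maximal CR dimension means that the real dimension \<open>dim\<close> of the
  holomorphic tangent space is 2.\<close>

definition maximal_CR_dimension3 ::
    "('m, real^3) chart set \<Rightarrow> ('m \<Rightarrow> 'n::finite cproj) \<Rightarrow> bool" where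
  "maximal_CR_dimension3 A f \<longleftrightarrow> (\<forall>c\<in>A. \<forall>d\<in>cproj_atlas. \<forall>u\<in>coord_dom c d f.
     dim (holomorphic_tangent_space (coord_rep c d f) u) = 2)"

definition flat_normal_connection ::
    "('m, 'a::euclidean_space) chart set \<Rightarrow> ('m \<Rightarrow> 'n::finite cproj) \<Rightarrow> bool" where
  "flat_normal_connection A f \<longleftrightarrow> (\<forall>c\<in>A. \<forall>d\<in>cproj_atlas.
     normal_flat fubini_study (coord_rep c d f) (coord_dom c d f))"

definition distinguished_normal ::
    "('a::euclidean_space \<Rightarrow> complex^'n) \<Rightarrow> 'a \<Rightarrow> complex^'n \<Rightarrow> bool" where
  "distinguished_normal F u \<xi> \<longleftrightarrow> \<xi> \<in> normal_space fubini_study F u \<and> fubini_study (F u) \<xi> \<xi> = 1 \<and>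
     cplx_J ` tangent_space F u \<subseteq> {t + r *\<^sub>R \<xi> | t r. t \<in> tangent_space F u}"

definition distinguished_normal_umbilical ::
    "('m, real^'k) chart set \<Rightarrow> ('m \<Rightarrow> 'n::finite cproj) \<Rightarrow> 'm \<Rightarrow> bool" where
  "distinguished_normal_umbilical A f x \<longleftrightarrow>
     (\<forall>c\<in>A. \<forall>d\<in>cproj_atlas. x \<in> fst c \<and> f x \<in> fst d \<longrightarrow>
       (\<forall>\<xi>. distinguished_normal (coord_rep c d f) (snd c x) \<xi> \<longrightarrow>
          umbilical fubini_study (coord_rep c d f) (snd c x) \<xi>))"

end

theory Submission
  imports Defs
begin

text \<open>The hypotheses are contradictory. As \<open>p > 1\<close>, the tangent space \<open>T\<close> and \<open>J T\<close> together span a space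
  of real dimension 4, less than that of the ambient space, so that locally there is a nonvanishing
  normal field \<open>\<eta>\<close> for which \<open>J \<eta>\<close> is normal too. Take tangent vectors \<open>X\<close> and \<open>Y = J X \<noteq> 0\<close>. With vanishing
  normal curvature, the Ricci equation for \<open>X\<close>, \<open>Y\<close>, \<open>\<eta>\<close>, \<open>J \<eta>\<close> reads
  \<open>2 \<bar>X\<bar>\<^sup>2 \<bar>\<eta>\<bar>\<^sup>2 = \<langle>[A\<^sub>\<eta>, A\<^sub>J\<^sub>\<eta>] X, Y\<rangle>\<close>. Since \<open>J\<close> is parallel, \<open>A\<^sub>J\<^sub>\<eta> X = - A\<^sub>\<eta> Y\<close> and
  \<open>A\<^sub>J\<^sub>\<eta> Y = A\<^sub>\<eta> X\<close>, so that the right-hand side is \<open>- \<bar>A\<^sub>\<eta> X\<bar>\<^sup>2 - \<bar>A\<^sub>\<eta> Y\<bar>\<^sup>2\<close>.\<close>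

section \<open>Calculus of smooth maps\<close>

abbreviation fderiv :: "('a::euclidean_space \<Rightarrow> 'b::euclidean_space) \<Rightarrow> 'a \<Rightarrow> 'a \<Rightarrow> 'b" where
  "fderiv f u \<equiv> frechet_derivative f (at u)"

lemma fderiv_eq: "(f has_derivative D) (at u) \<Longrightarrow> fderiv f u = D"
  by (metis frechet_derivative_at)

lemma fderiv_has_derivative: "f differentiable (at u) \<Longrightarrow> (f has_derivative fderiv f u) (at u)"
  by (simp add: frechet_derivative_works)

text \<open>On an open set, agreement on S is agreement near each of its points, so the derivatives
  agree as well and the induction can continue.\<close>

lemma cont_diff_cong:
  assumes "open S" "\<And>u. u \<in> S \<Longrightarrow> f u = g u" "cont_diff k f S"
  shows "cont_diff k g S"
  using assms(2,3)
proof (induction k arbitrary: f g)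
  case 0
  then show ?case by (metis cont_diff.simps(1) continuous_on_cong)
next
  case (Suc k)
  have D: "g differentiable (at u) \<and> fderiv g u = fderiv f u" if "u \<in> S" for u
  proof -
    have "(f has_derivative fderiv f u) (at u)"
      using Suc.prems that by (simp add: fderiv_has_derivative)
    then have "(g has_derivative fderiv f u) (at u)"
      by (rule has_derivative_transform_within_open[OF _ assms(1) that]) (use Suc.prems in auto)
    then show ?thesis
      by (auto simp: differentiable_def fderiv_eq)
  qed
  have "cont_diff k (\<lambda>u. fderiv g u v) S" for v
    by (rule Suc.IH[of "\<lambda>u. fderiv f u v"]) (use Suc.prems D in auto)
  then show ?case using D by simp
qed

lemma cont_diff_subset: "cont_diff k f S \<Longrightarrow> T \<subseteq> S \<Longrightarrow> cont_diff k f T"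
  by (induction k arbitrary: f) (auto intro: continuous_on_subset)

lemma cont_diff_Suc_imp: "cont_diff (Suc k) f S \<Longrightarrow> cont_diff k f S"
proof (induction k arbitrary: f)
  case 0
  then show ?case
    by (auto intro!: continuous_at_imp_continuous_on differentiable_imp_continuous_within)
next
  case (Suc k)
  then show ?case by (metis cont_diff.simps(2))
qed

lemma cont_diff_const: "cont_diff k (\<lambda>u. c) S"
  by (induction k arbitrary: c) auto

text \<open>Replaces \<open>frechet_derivative\<close> by an explicit derivative, as supplied by the
  product and quotient rules in the inductions below.\<close>

lemma cont_diff_SucI:
  assumes "open S" "\<And>u. u \<in> S \<Longrightarrow> (f has_derivative D u) (at u)" "\<And>v. cont_diff k (\<lambda>u. D u v) S"
  shows "cont_diff (Suc k) f S"
proof -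
  have "cont_diff k (\<lambda>u. fderiv f u v) S" for v
    using fderiv_eq[OF assms(2)] by (intro cont_diff_cong[OF assms(1) _ assms(3)[of v]]) simp
  then show ?thesis
    using assms by (auto simp: differentiable_def)
qed

lemma cont_diff_SucD:
  assumes "cont_diff (Suc k) f S"
  shows "u \<in> S \<Longrightarrow> (f has_derivative fderiv f u) (at u)" "cont_diff k (\<lambda>u. fderiv f u v) S"
  using assms by (auto simp: fderiv_has_derivative)

lemma cont_diff_linear:
  assumes "open S" "bounded_linear L" "cont_diff k f S"
  shows "cont_diff k (\<lambda>u. L (f u)) S"
  using assms(3)
proof (induction k arbitrary: f)
  case 0
  then show ?case
    using linear_continuous_on_compose[OF _ bounded_linear.linear[OF assms(2)]] by auto
next
  case (Suc k)
  show ?case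
    by (rule cont_diff_SucI[OF assms(1)], rule bounded_linear.has_derivative[OF assms(2)],
        erule cont_diff_SucD[OF Suc.prems]) (intro Suc.IH cont_diff_SucD[OF Suc.prems])
qed

lemma cont_diff_add:
  assumes "open S" "cont_diff k f S" "cont_diff k g S"
  shows "cont_diff k (\<lambda>u. f u + g u) S"
  using assms(2,3)
proof (induction k arbitrary: f g)
  case 0
  then show ?case by (auto intro: continuous_intros)
next
  case (Suc k)
  show ?case
    by (rule cont_diff_SucI[OF assms(1)], rule has_derivative_add)
      (use Suc in \<open>auto intro: cont_diff_SucD\<close>)
qed

lemma cont_diff_bilinear:
  assumes "open S" "bounded_bilinear B" "cont_diff k f S" "cont_diff k g S"
  shows "cont_diff k (\<lambda>u. B (f u) (g u)) S"
  using assms(3,4)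
proof (induction k arbitrary: f g)
  case 0
  then show ?case using bounded_bilinear.continuous_on[OF assms(2)] by auto
next
  case (Suc k)
  \<comment> \<open>Each Leibniz term pairs one derivative of order k with an undifferentiated
    factor, which must be lowered to order k.\<close>
  note fg = cont_diff_Suc_imp[OF Suc.prems(1)] cont_diff_Suc_imp[OF Suc.prems(2)]
  show ?case
    by (rule cont_diff_SucI[OF assms(1)], rule bounded_bilinear.FDERIV[OF assms(2)])
      (use Suc fg in \<open>auto intro: cont_diff_SucD cont_diff_add assms\<close>)
qed

text \<open>The derivative of \<open>inverse (f u)\<close> contains \<open>inverse (f u)\<close>
  again, but only at order k, where the induction hypothesis applies. The type class covers both the
  complex denominators of \<open>fs_phi\<close> and the real coefficients of Gram--Schmidt.\<close>

lemma cont_diff_inverse: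
  fixes f :: "'a::euclidean_space \<Rightarrow> 'b::{euclidean_space, real_normed_div_algebra}"
  assumes "open S" "\<And>u. u \<in> S \<Longrightarrow> f u \<noteq> 0" "cont_diff k f S"
  shows "cont_diff k (\<lambda>u. inverse (f u)) S"
  using assms(3)
proof (induction k)
  case 0
  then show ?case using assms(2) by (auto intro: continuous_intros)
next
  case (Suc k)
  have "cont_diff k (\<lambda>u. inverse (f u)) S"
    using Suc cont_diff_Suc_imp by blast
  moreover have "bounded_linear (uminus :: 'b \<Rightarrow> 'b)"
    by (simp add: bounded_linear_minus bounded_linear_ident)
  ultimately have "cont_diff k (\<lambda>u. - (inverse (f u) * fderiv f u v * inverse (f u))) S" for v
    using cont_diff_SucD(2)[OF Suc.prems]
    by (intro cont_diff_linear[OF assms(1), where L = uminus]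
        cont_diff_bilinear[OF assms(1) bounded_bilinear_mult])
  moreover have "((\<lambda>u. inverse (f u)) has_derivative
      (\<lambda>v. - (inverse (f u) * fderiv f u v * inverse (f u)))) (at u)" if "u \<in> S" for u
    by (rule Deriv.has_derivative_inverse[OF assms(2)[OF that] cont_diff_SucD(1)[OF Suc.prems that]])
  ultimately show ?case
    by (rule cont_diff_SucI[OF assms(1), rotated])
qed

lemma smooth_on_cong: "open S \<Longrightarrow> smooth_on f S \<Longrightarrow> (\<And>u. u \<in> S \<Longrightarrow> f u = g u) \<Longrightarrow> smooth_on g S"
  unfolding smooth_on_def using cont_diff_cong by blast

lemma smooth_on_subset: "smooth_on f S \<Longrightarrow> T \<subseteq> S \<Longrightarrow> smooth_on f T"
  unfolding smooth_on_def using cont_diff_subset by blast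

lemma smooth_on_const: "smooth_on (\<lambda>u. c) S"
  by (simp add: smooth_on_def cont_diff_const)

lemma smooth_on_linear: "open S \<Longrightarrow> bounded_linear L \<Longrightarrow> smooth_on f S \<Longrightarrow> smooth_on (\<lambda>u. L (f u)) S"
  by (simp add: smooth_on_def cont_diff_linear)

lemma smooth_on_add: "open S \<Longrightarrow> smooth_on f S \<Longrightarrow> smooth_on g S \<Longrightarrow> smooth_on (\<lambda>u. f u + g u) S"
  by (simp add: smooth_on_def cont_diff_add)

lemma smooth_on_diff:
  assumes "open S" "smooth_on f S" "smooth_on g S"
  shows "smooth_on (\<lambda>u. f u - g u) S"
  using smooth_on_add[OF assms(1,2)
      smooth_on_linear[OF assms(1) bounded_linear_minus[OF bounded_linear_ident] assms(3)]] by simp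

lemma smooth_on_bilinear:
  "open S \<Longrightarrow> bounded_bilinear B \<Longrightarrow> smooth_on f S \<Longrightarrow> smooth_on g S \<Longrightarrow> smooth_on (\<lambda>u. B (f u) (g u)) S"
  by (simp add: smooth_on_def cont_diff_bilinear)

lemma smooth_on_inverse:
  fixes f :: "'a::euclidean_space \<Rightarrow> 'b::{euclidean_space, real_normed_div_algebra}"
  shows "open S \<Longrightarrow> (\<And>u. u \<in> S \<Longrightarrow> f u \<noteq> 0) \<Longrightarrow> smooth_on f S \<Longrightarrow> smooth_on (\<lambda>u. inverse (f u)) S"
  by (simp add: smooth_on_def cont_diff_inverse)

lemma smooth_on_fderiv: "smooth_on f S \<Longrightarrow> smooth_on (\<lambda>u. fderiv f u v) S"
  unfolding smooth_on_def using cont_diff.simps(2) by blast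

lemma smooth_on_differentiable: "smooth_on f S \<Longrightarrow> u \<in> S \<Longrightarrow> f differentiable (at u)"
  unfolding smooth_on_def using cont_diff.simps(2) by blast

lemma smooth_on_has_derivative: "smooth_on f S \<Longrightarrow> u \<in> S \<Longrightarrow> (f has_derivative fderiv f u) (at u)"
  by (simp add: fderiv_has_derivative smooth_on_differentiable)

lemma smooth_on_continuous: "smooth_on f S \<Longrightarrow> continuous_on S f"
  by (metis cont_diff.simps(1) smooth_on_def)

section \<open>Symmetry of second derivatives\<close>

lemma second_difference_mean_value:
  fixes f :: "'a::euclidean_space \<Rightarrow> real"
  assumes "open S" "smooth_on f S" "s > 0"
    and S: "\<And>x y. 0 \<le> x \<Longrightarrow> x \<le> s \<Longrightarrow> 0 \<le> y \<Longrightarrow> y \<le> s \<Longrightarrow> u + x *\<^sub>R v + y *\<^sub>R w \<in> S"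
  shows "\<exists>x y. 0 \<le> x \<and> x \<le> s \<and> 0 \<le> y \<and> y \<le> s \<and>
    f (u + s *\<^sub>R v + s *\<^sub>R w) - f (u + s *\<^sub>R v) - f (u + s *\<^sub>R w) + f u =
    s * (s * fderiv (\<lambda>q. fderiv f q v) (u + x *\<^sub>R v + y *\<^sub>R w) w)"
proof -
  \<comment> \<open>\<open>d x\<close> is the increment of f along \<open>s *\<^sub>R w\<close> from
    \<open>u + x *\<^sub>R v\<close>. The mean value theorem in x turns the second difference
    \<open>d s - d 0\<close> into a difference of derivatives along v; a second application, in y,
    turns that into a second derivative.\<close>
  define d where "d x = f (u + x *\<^sub>R v + s *\<^sub>R w) - f (u + x *\<^sub>R v)" for x
  have line: "((\<lambda>x. u + x *\<^sub>R v + y *\<^sub>R w) has_derivative (\<lambda>t. t *\<^sub>R v)) (at x within A)" for x y A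
    by (auto intro!: derivative_eq_intros)
  have line': "((\<lambda>y. u + x *\<^sub>R v + y *\<^sub>R w) has_derivative (\<lambda>t. t *\<^sub>R w)) (at y within A)" for x y A
    by (auto intro!: derivative_eq_intros)
  have lin: "fderiv g q (t *\<^sub>R z) = t * fderiv g q z" if "smooth_on g S" "q \<in> S"
    for g :: "'a \<Rightarrow> real" and q t z
    using linear_scale[OF has_derivative_linear[OF smooth_on_has_derivative[OF that]]] by simp
  have comp: "((\<lambda>x. f (u + x *\<^sub>R v + y *\<^sub>R w)) has_derivative
      (\<lambda>t. t * fderiv f (u + x *\<^sub>R v + y *\<^sub>R w) v)) (at x within A)"
    if "0 \<le> x" "x \<le> s" "0 \<le> y" "y \<le> s" for x y A
    using has_derivative_compose[OF line smooth_on_has_derivative[OF assms(2) S[OF that]]]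
    by (simp add: lin[OF assms(2) S[OF that]])
  have comp': "((\<lambda>y. fderiv f (u + x *\<^sub>R v + y *\<^sub>R w) v) has_derivative
      (\<lambda>t. t * fderiv (\<lambda>q. fderiv f q v) (u + x *\<^sub>R v + y *\<^sub>R w) w)) (at y within A)"
    if "0 \<le> x" "x \<le> s" "0 \<le> y" "y \<le> s" for x y A
    using has_derivative_compose[OF line' smooth_on_has_derivative[OF smooth_on_fderiv[OF assms(2)] S[OF that]]]
    by (simp add: lin[OF smooth_on_fderiv[OF assms(2)] S[OF that]])
  have "(d has_derivative (\<lambda>t. t * (fderiv f (u + x *\<^sub>R v + s *\<^sub>R w) v - fderiv f (u + x *\<^sub>R v) v)))
      (at x within {0..s})" if "0 \<le> x" "x \<le> s" for x
    unfolding d_def using comp[OF that, of s] comp[OF that, of 0] assms(3)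
    by (auto intro!: derivative_eq_intros simp: algebra_simps)
  from mvt_very_simple[OF less_imp_le[OF assms(3)] this] obtain x where x: "0 \<le> x" "x \<le> s"
    and dx: "d s - d 0 = s * (fderiv f (u + x *\<^sub>R v + s *\<^sub>R w) v - fderiv f (u + x *\<^sub>R v) v)"
    by auto
  from mvt_very_simple[OF less_imp_le[OF assms(3)] comp'[OF x]] obtain y where y: "0 \<le> y" "y \<le> s"
    and dy: "fderiv f (u + x *\<^sub>R v + s *\<^sub>R w) v - fderiv f (u + x *\<^sub>R v) v =
        s * fderiv (\<lambda>q. fderiv f q v) (u + x *\<^sub>R v + y *\<^sub>R w) w"
    by auto
  show ?thesis
    using x y dx unfolding dy d_def by (intro exI[of _ x] exI[of _ y]) (auto simp: algebra_simps)
qed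

text \<open>The second difference over a parallelogram is unchanged when v and w are swapped. Being
  \<open>s * s\<close> times either mixed derivative at some nearby point, it gives the two mixed
  derivatives a common value near u; continuity then excludes different values at u.\<close>

lemma smooth_on_second_derivative_symmetric_real:
  fixes f :: "'a::euclidean_space \<Rightarrow> real"
  assumes "open S" "smooth_on f S" "u \<in> S"
  shows "fderiv (\<lambda>q. fderiv f q v) u w = fderiv (\<lambda>q. fderiv f q w) u v"
proof (rule ccontr)
  define D where "D v w q = fderiv (\<lambda>q. fderiv f q v) q w" for v w q
  assume "\<not> ?thesis"
  \<comment> \<open>Half the supposed gap, so that no number is closer than this to both values at
    u.\<close>
  then have e: "\<bar>D v w u - D w v u\<bar> / 2 > 0" (is "?e > 0")
    by (simp add: D_def)
  have cont: "isCont (D v w) u" for v w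
    using smooth_on_continuous[OF smooth_on_fderiv[OF smooth_on_fderiv[OF assms(2)]]] assms(1,3)
    unfolding D_def by (simp add: continuous_on_eq_continuous_at)
  have "eventually (\<lambda>q. q \<in> S \<and> dist (D v w q) (D v w u) < ?e \<and> dist (D w v q) (D w v u) < ?e) (at u)"
    using cont[unfolded isCont_def] e assms(1,3)
    by (intro eventually_conj tendstoD) (auto simp: eventually_at_topological)
  then obtain r where r: "r > 0" and near: "\<And>q. dist q u < r \<Longrightarrow>
      q \<in> S \<and> dist (D v w q) (D v w u) < ?e \<and> dist (D w v q) (D w v u) < ?e"
    using e assms(3) unfolding eventually_at by (metis UNIV_I dist_self)
  \<comment> \<open>Small enough for the parallelogram with sides \<open>s *\<^sub>R v\<close> and
    \<open>s *\<^sub>R w\<close> at u to stay within r of u; the 1 keeps the denominator positive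
    when both vectors vanish.\<close>
  define s where "s = r / (2 * (norm v + norm w + 1))"
  have s: "s > 0"
    using r unfolding s_def by (intro divide_pos_pos) (auto simp: add_nonneg_pos)
  have dist: "dist (u + x *\<^sub>R v + y *\<^sub>R w) u < r" if "0 \<le> x" "x \<le> s" "0 \<le> y" "y \<le> s" for x y
  proof -
    have "norm (x *\<^sub>R v + y *\<^sub>R w) \<le> s * norm v + s * norm w"
      using that by (intro norm_triangle_mono) (auto intro: mult_right_mono)
    also have "\<dots> \<le> s * (norm v + norm w + 1)"
      using s by (simp add: algebra_simps)
    also have "\<dots> = r / 2"
      unfolding s_def using norm_ge_zero[of v] norm_ge_zero[of w]
      by (simp add: field_simps add_nonneg_eq_0_iff)
    finally show ?thesis
      using r by (simp add: dist_norm add.assoc)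
  qed
  obtain x y where xy: "0 \<le> x" "x \<le> s" "0 \<le> y" "y \<le> s" and 1:
    "f (u + s *\<^sub>R v + s *\<^sub>R w) - f (u + s *\<^sub>R v) - f (u + s *\<^sub>R w) + f u
      = s * (s * D v w (u + x *\<^sub>R v + y *\<^sub>R w))"
    using second_difference_mean_value[OF assms(1,2) s, of u v w] dist near unfolding D_def by blast
  have "u + x *\<^sub>R w + y *\<^sub>R v \<in> S" if "0 \<le> x" "x \<le> s" "0 \<le> y" "y \<le> s" for x y
    using near[OF dist[OF that(3,4,1,2)]] by (simp add: ac_simps)
  then obtain x' y' where xy': "0 \<le> x'" "x' \<le> s" "0 \<le> y'" "y' \<le> s" and 2:
    "f (u + s *\<^sub>R w + s *\<^sub>R v) - f (u + s *\<^sub>R w) - f (u + s *\<^sub>R v) + f u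
      = s * (s * D w v (u + x' *\<^sub>R w + y' *\<^sub>R v))"
    using second_difference_mean_value[OF assms(1,2) s, of u w v] unfolding D_def by blast
  have "D v w (u + x *\<^sub>R v + y *\<^sub>R w) = D w v (u + y' *\<^sub>R v + x' *\<^sub>R w)"
  proof -
    have eqs: "u + s *\<^sub>R w + s *\<^sub>R v = u + s *\<^sub>R v + s *\<^sub>R w"
      "u + x' *\<^sub>R w + y' *\<^sub>R v = u + y' *\<^sub>R v + x' *\<^sub>R w"
      by (simp_all add: ac_simps)
    then have "s * (s * D v w (u + x *\<^sub>R v + y *\<^sub>R w)) = s * (s * D w v (u + y' *\<^sub>R v + x' *\<^sub>R w))"
      using 1 2 unfolding eqs by linarith
    then show ?thesis
      using s by simp
  qed
  moreover have "dist (D v w (u + x *\<^sub>R v + y *\<^sub>R w)) (D v w u) < ?e"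
    "dist (D w v (u + y' *\<^sub>R v + x' *\<^sub>R w)) (D w v u) < ?e"
    using near[OF dist[OF xy]] near[OF dist[OF xy'(3,4,1,2)]] by auto
  ultimately show False
    using dist_triangle3[of "D v w u" "D w v u" "D v w (u + x *\<^sub>R v + y *\<^sub>R w)"]
    by (simp add: dist_real_def)
qed

text \<open>Reduces to real functions by taking components, which commutes with
  differentiation.\<close>

lemma smooth_on_second_derivative_symmetric:
  fixes f :: "'a::euclidean_space \<Rightarrow> 'b::euclidean_space"
  assumes "open S" "smooth_on f S" "u \<in> S"
  shows "fderiv (\<lambda>q. fderiv f q v) u w = fderiv (\<lambda>q. fderiv f q w) u v"
proof (rule euclidean_eqI)
  fix b :: 'b
  assume "b \<in> Basis"
  have D: "fderiv (\<lambda>q. g q \<bullet> b) q z = fderiv g q z \<bullet> b" if "smooth_on g S" "q \<in> S"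
    for g :: "'a \<Rightarrow> 'b" and q z
    using fderiv_eq[OF has_derivative_inner_left[OF smooth_on_has_derivative[OF that]]] by simp
  have D2: "fderiv (\<lambda>q. fderiv (\<lambda>q. f q \<bullet> b) q v) u w = fderiv (\<lambda>q. fderiv f q v) u w \<bullet> b" for v w
  proof -
    have 1: "((\<lambda>q. fderiv f q v \<bullet> b) has_derivative fderiv (\<lambda>q. fderiv f q v \<bullet> b) u) (at u)"
      by (rule smooth_on_has_derivative[OF smooth_on_linear[OF assms(1) bounded_linear_inner_left
            smooth_on_fderiv[OF assms(2)]] assms(3)])
    have "((\<lambda>q. fderiv (\<lambda>q. f q \<bullet> b) q v) has_derivative fderiv (\<lambda>q. fderiv f q v \<bullet> b) u) (at u)"
      by (rule has_derivative_transform_within_open[OF 1 assms(1,3)]) (simp add: D[OF assms(2)])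
    from fderiv_eq[OF this] have "fderiv (\<lambda>q. fderiv (\<lambda>q. f q \<bullet> b) q v) u = fderiv (\<lambda>q. fderiv f q v \<bullet> b) u" .
    then show ?thesis
      using D[OF smooth_on_fderiv[OF assms(2)] assms(3)] by simp
  qed
  show "fderiv (\<lambda>q. fderiv f q v) u w \<bullet> b = fderiv (\<lambda>q. fderiv f q w) u v \<bullet> b"
    using smooth_on_second_derivative_symmetric_real[OF assms(1)
        smooth_on_linear[OF assms(1) bounded_linear_inner_left assms(2)] assms(3), of b v w] D2
    by simp
qed

section \<open>The Fubini--Study metric\<close>

text \<open>The (1,0)-part, evaluated at v, of the differential at w of the Kaehler potential log (1
  + |w|^2).\<close>

definition fs_phi :: "complex^'n \<Rightarrow> complex^'n \<Rightarrow> complex" where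
  "fs_phi w v = herm v w / (1 + herm w w)"

text \<open>The complex Hessian of the potential. Its real part is the metric; keeping it complex
  treats a vector and its multiple by \<i> together.\<close>

definition fs_herm :: "complex^'n \<Rightarrow> complex^'n \<Rightarrow> complex^'n \<Rightarrow> complex" where
  "fs_herm w u v = herm u v / (1 + herm w w) - fs_phi w u * cnj (fs_phi w v)"

text \<open>The Christoffel symbols of the Kaehler metric. Complex bilinearity makes J parallel, and
  symmetry makes the connection torsion-free.\<close>

definition fs_christoffel :: "complex^'n \<Rightarrow> complex^'n \<Rightarrow> complex^'n \<Rightarrow> complex^'n" where
  "fs_christoffel w u v = - (fs_phi w u *s v + fs_phi w v *s u)"

lemma cnj_herm: "cnj (herm u v) = herm v u"
  by (simp add: herm_def mult.commute)

lemma fs_denominator_nonzero: "1 + herm w w \<noteq> 0"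
proof -
  have "Re (1 + herm w w) > 0"
    by (simp add: herm_self add_pos_nonneg)
  then show ?thesis by force
qed

lemma fubini_study_eq: "fubini_study w u v = Re (fs_herm w u v)"
proof -
  have "((1 + herm w w) * herm u v - herm u w * herm w v) / (1 + herm w w)\<^sup>2 = fs_herm w u v"
  proof -
    define \<rho> where "\<rho> = 1 + herm w w"
    have "\<rho> \<noteq> 0" "cnj \<rho> = \<rho>"
      by (simp_all add: \<rho>_def fs_denominator_nonzero cnj_herm)
    then show ?thesis
      unfolding fs_herm_def fs_phi_def \<rho>_def[symmetric]
      by (simp add: cnj_herm field_simps power2_eq_square)
  qed
  then show ?thesis
    by (simp add: fubini_study_def)
qed

lemma fs_phi_linear: "fs_phi w (u + v) = fs_phi w u + fs_phi w v" "fs_phi w (c *s u) = c * fs_phi w u"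
  by (simp_all add: fs_phi_def herm_add_left herm_scale_left add_divide_distrib)

lemma fs_herm_sesquilinear:
  "fs_herm w (u + u') v = fs_herm w u v + fs_herm w u' v"
  "fs_herm w u (v + v') = fs_herm w u v + fs_herm w u v'"
  "fs_herm w (c *s u) v = c * fs_herm w u v"
  "fs_herm w u (c *s v) = cnj c * fs_herm w u v"
  "cnj (fs_herm w u v) = fs_herm w v u"
  by (simp_all add: fs_herm_def fs_phi_linear herm_add_left herm_add_right herm_scale_left
      herm_scale_right cnj_herm algebra_simps add_divide_distrib)

lemma scaleR_eq_vector_smult: "r *\<^sub>R v = complex_of_real r *s v" for v :: "complex^'n"
  by (simp add: vec_eq_iff) (simp add: scaleR_conv_of_real)

lemma bounded_linear_smult: "bounded_linear (\<lambda>v :: complex^'n. c *s v)"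
  by (rule linear_conv_bounded_linear[THEN iffD1, OF linearI])
     (simp_all add: vector_add_ldistrib scaleR_eq_vector_smult vector_smult_assoc mult.commute)

lemma bounded_bilinear_smult: "bounded_bilinear (\<lambda>c (v :: complex^'n). c *s v)"
  unfolding bilinear_conv_bounded_bilinear[symmetric] bilinear_def
  by (auto intro!: linearI simp: vector_add_ldistrib vector_sadd_rdistrib scaleR_eq_vector_smult
      vector_smult_assoc mult.commute scaleR_conv_of_real)

lemma bounded_bilinear_herm: "bounded_bilinear (herm :: complex^'n \<Rightarrow> complex^'n \<Rightarrow> complex)"
  unfolding bilinear_conv_bounded_bilinear[symmetric] bilinear_def
  by (auto intro!: linearI simp: herm_add_left herm_add_right herm_scale_left herm_scale_right
      scaleR_eq_vector_smult scaleR_conv_of_real)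

text \<open>Cauchy--Schwarz bounds the subtracted term by \<open>herm w w * herm u u\<close>, so the
  1 in \<open>1 + herm w w\<close> leaves at least \<open>herm u u\<close> in the numerator.\<close>

lemma fs_herm_self_pos:
  assumes "u \<noteq> 0"
  shows "Re (fs_herm w u u) > 0"
proof -
  have "Re (herm u w * herm w u) \<le> Re (herm w w * herm u u)"
  proof -
    \<comment> \<open>\<open>c *s u\<close> is the projection of w to the complex line of u; the
      squared norm of the remainder is the deficit in Cauchy--Schwarz divided by
      \<open>herm u u\<close>.\<close>
    define c where "c = herm w u / herm u u"
    have uu: "herm u u \<noteq> 0" "Re (herm u u) > 0" "Im (herm u u) = 0"
      using assms by (simp_all add: herm_self)
    have "0 \<le> Re (herm (w + (- c) *s u) (w + (- c) *s u))"
      by (simp add: herm_self)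
    also have "herm (w + (- c) *s u) (w + (- c) *s u) = herm w w - herm u w * herm w u / herm u u"
      using uu(1) unfolding herm_add_left herm_add_right herm_scale_left herm_scale_right c_def
      by (simp add: cnj_herm field_simps)
    finally have "Re (herm u w * herm w u / herm u u) \<le> Re (herm w w)"
      by simp
    then have "Re (herm u w * herm w u) / Re (herm u u) \<le> Re (herm w w)"
      using uu by (simp add: herm_self)
    then show ?thesis
      using uu by (simp add: field_simps herm_self)
  qed
  moreover have "Re (herm u u) > 0"
    using assms by (simp add: herm_self)
  ultimately have "Re ((1 + herm w w) * herm u u - herm u w * herm w u) > 0"
    by (simp add: algebra_simps)
  moreover have "(1 + herm w w)\<^sup>2 = complex_of_real ((1 + (norm w)\<^sup>2)\<^sup>2)"
    by (simp add: herm_self)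
  moreover have "(1 + (norm w)\<^sup>2)\<^sup>2 > 0"
    by (smt (verit) zero_le_power2 zero_less_power)
  ultimately have "fubini_study w u u > 0"
    unfolding fubini_study_def by (simp only: Re_divide_of_real zero_less_divide_iff) simp
  then show ?thesis
    by (simp add: fubini_study_eq)
qed

lemma fubini_study_pos: "u \<noteq> 0 \<Longrightarrow> fubini_study w u u > 0"
  by (simp add: fubini_study_eq fs_herm_self_pos)

lemma fubini_study_commute: "fubini_study w u v = fubini_study w v u"
  unfolding fubini_study_eq using fs_herm_sesquilinear(5)[of w v u] by (metis complex_cnj(1) complex_surj complex.sel(1))

lemma bilinear_fubini_study: "bilinear (fubini_study w)"
  unfolding bilinear_def fubini_study_eq
  by (auto intro!: linearI simp: fs_herm_sesquilinear scaleR_eq_vector_smult)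

lemma fubini_study_linear_left: "linear (\<lambda>u. fubini_study w u v)"
  using bilinear_fubini_study unfolding bilinear_def by blast

lemma fubini_study_linear_right: "linear (\<lambda>v. fubini_study w u v)"
  using bilinear_fubini_study unfolding bilinear_def by blast

lemma fubini_study_simps:
  "fubini_study w (u + u') v = fubini_study w u v + fubini_study w u' v"
  "fubini_study w u (v + v') = fubini_study w u v + fubini_study w u v'"
  "fubini_study w (u - u') v = fubini_study w u v - fubini_study w u' v"
  "fubini_study w u (v - v') = fubini_study w u v - fubini_study w u v'"
  "fubini_study w (- u) v = - fubini_study w u v"
  "fubini_study w u (- v) = - fubini_study w u v"
  "fubini_study w (r *\<^sub>R u) v = r * fubini_study w u v"
  "fubini_study w u (r *\<^sub>R v) = r * fubini_study w u v"
  "fubini_study w 0 v = 0"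
  "fubini_study w u 0 = 0"
  using linear_add[OF fubini_study_linear_left] linear_add[OF fubini_study_linear_right]
    linear_diff[OF fubini_study_linear_left] linear_diff[OF fubini_study_linear_right]
    linear_neg[OF fubini_study_linear_left] linear_neg[OF fubini_study_linear_right]
    linear_scale[OF fubini_study_linear_left] linear_scale[OF fubini_study_linear_right]
    linear_0[OF fubini_study_linear_left] linear_0[OF fubini_study_linear_right]
  by auto

lemma fubini_study_J_left: "fubini_study w (\<i> *s u) v = - fubini_study w u (\<i> *s v)"
  by (simp add: fubini_study_eq fs_herm_sesquilinear)

lemma fs_christoffel_commute: "fs_christoffel w u v = fs_christoffel w v u"
  by (simp add: fs_christoffel_def)

section \<open>The Levi-Civita derivative along a map, with explicit Christoffel symbols\<close>

definition fs_deriv ::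
    "('a::euclidean_space \<Rightarrow> complex^'n) \<Rightarrow> ('a \<Rightarrow> complex^'n) \<Rightarrow> 'a \<Rightarrow> 'a \<Rightarrow> complex^'n" where
  "fs_deriv F V u a = fderiv V u a + fs_christoffel (F u) (fderiv F u a) (V u)"

text \<open>The base point enters \<open>fs_phi\<close> both holomorphically and
  antiholomorphically. The part conjugate-linear in the velocity of F gives the
  \<open>fs_herm\<close> term, the complex-linear part the product of two \<open>fs_phi\<close>
  values.\<close>

lemma fs_phi_has_derivative:
  fixes F V :: "'a::euclidean_space \<Rightarrow> complex^'n"
  assumes "(F has_derivative F') (at u)" "(V has_derivative V') (at u)"
  shows "((\<lambda>q. fs_phi (F q) (V q)) has_derivative
    (\<lambda>a. fs_phi (F u) (V' a) + fs_herm (F u) (V u) (F' a) - fs_phi (F u) (V u) * fs_phi (F u) (F' a))) (at u)"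
proof -
  note [derivative_intros] = bounded_bilinear.FDERIV[OF bounded_bilinear_herm]
  define \<rho> where "\<rho> = 1 + herm (F u) (F u)"
  have \<rho>: "\<rho> \<noteq> 0" "cnj \<rho> = \<rho>"
    by (simp_all add: \<rho>_def fs_denominator_nonzero cnj_herm)
  show ?thesis
    unfolding fs_phi_def[abs_def]
    apply (rule has_derivative_eq_rhs)
     apply (rule derivative_intros assms fs_denominator_nonzero)+
    unfolding fs_herm_def fs_phi_def \<rho>_def[symmetric] using \<rho>
    by (simp add: cnj_herm fun_eq_iff field_simps power2_eq_square)
qed

text \<open>Metric compatibility holds already for the complex form: the terms from differentiating
  the base point are exactly those that \<open>fs_christoffel\<close> adds to the derivatives of V
  and W.\<close>

lemma fs_herm_has_derivative:
  fixes F V :: "'a::euclidean_space \<Rightarrow> complex^'n"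
  assumes "F differentiable (at u)" "V differentiable (at u)" "W differentiable (at u)"
  shows "((\<lambda>q. fs_herm (F q) (V q) (W q)) has_derivative
    (\<lambda>a. fs_herm (F u) (fs_deriv F V u a) (W u) + fs_herm (F u) (V u) (fs_deriv F W u a))) (at u)"
proof -
  note [derivative_intros] = bounded_bilinear.FDERIV[OF bounded_bilinear_herm] 
    bounded_linear.has_derivative[OF bounded_linear_cnj]
  note D = assms[THEN fderiv_has_derivative]
  have neg: "fs_herm w (- x) y = - fs_herm w x y" "fs_herm w y (- x) = - fs_herm w y x" for w x y :: "complex^'n"
    using fs_herm_sesquilinear(3)[of w "-1" x y] fs_herm_sesquilinear(4)[of w y "-1" x]
    by (simp_all add: vector_sneg_minus1[symmetric])
  define \<rho> where "\<rho> = 1 + herm (F u) (F u)"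
  have \<rho>: "\<rho> \<noteq> 0" "cnj \<rho> = \<rho>"
    by (simp_all add: \<rho>_def fs_denominator_nonzero cnj_herm)
  \<comment> \<open>The facts h and p eliminate \<open>herm\<close> in favour of
    \<open>fs_herm\<close>, \<open>fs_phi\<close> and \<rho>, which leaves an algebraic
    identity.\<close>
  have h: "herm x y = \<rho> * (fs_herm (F u) x y + fs_phi (F u) x * cnj (fs_phi (F u) y))" for x y
    using \<rho> by (simp add: fs_herm_def \<rho>_def)
  have p: "herm x (F u) = \<rho> * fs_phi (F u) x" "herm (F u) x = \<rho> * cnj (fs_phi (F u) x)" for x
    using \<rho> by (simp_all add: fs_phi_def \<rho>_def[symmetric] cnj_herm)
  have expand: "fs_herm (F u) (fs_deriv F V u a) (W u) =
      fs_herm (F u) (fderiv V u a) (W u) - fs_phi (F u) (fderiv F u a) * fs_herm (F u) (V u) (W u)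
      - fs_phi (F u) (V u) * fs_herm (F u) (fderiv F u a) (W u)"
    "fs_herm (F u) (V u) (fs_deriv F W u a) =
      fs_herm (F u) (V u) (fderiv W u a) - cnj (fs_phi (F u) (fderiv F u a)) * fs_herm (F u) (V u) (W u)
      - cnj (fs_phi (F u) (W u)) * fs_herm (F u) (V u) (fderiv F u a)" for a
    unfolding fs_deriv_def fs_christoffel_def fs_herm_sesquilinear(1-4) neg complex_cnj_mult
    by simp_all
  show ?thesis
    apply (subst fs_herm_def[abs_def])
    apply (rule has_derivative_eq_rhs)
     apply (rule derivative_intros D fs_denominator_nonzero fs_phi_has_derivative)+
    unfolding \<rho>_def[symmetric]
    unfolding expand p
    unfolding h complex_cnj_add complex_cnj_diff complex_cnj_mult fs_herm_sesquilinear(5)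
    using \<rho> by (simp add: fun_eq_iff field_simps)
qed

lemma fubini_study_has_derivative:
  fixes F V W :: "'a::euclidean_space \<Rightarrow> complex^'n"
  assumes "F differentiable (at u)" "V differentiable (at u)" "W differentiable (at u)"
  shows "((\<lambda>q. fubini_study (F q) (V q) (W q)) has_derivative
    (\<lambda>a. fubini_study (F u) (fs_deriv F V u a) (W u) + fubini_study (F u) (V u) (fs_deriv F W u a))) (at u)"
  using bounded_linear.has_derivative[OF bounded_linear_Re fs_herm_has_derivative[OF assms]]
  by (simp add: fubini_study_eq)

lemma fubini_study_nondegenerate:
  assumes "\<And>x. fubini_study w u x = fubini_study w v x"
  shows "u = v"
  using assms[of "u - v"] fubini_study_pos[of "u - v" w] by (force simp: fubini_study_simps)

text \<open>Koszul's formula follows from metric compatibility, applied to constant fields along the identity,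
  and the symmetry of \<open>fs_christoffel\<close>.\<close>

lemma christoffel_fubini_study: "christoffel fubini_study w u v = fs_christoffel w u v"
proof -
  have D: "fderiv (\<lambda>q. fubini_study q x y) w z =
      fubini_study w (fs_christoffel w z x) y + fubini_study w x (fs_christoffel w z y)" for x y z
    using fun_cong[OF fderiv_eq[OF fubini_study_has_derivative[of "\<lambda>q. q" w "\<lambda>_. x" "\<lambda>_. y"]], of z]
    by (simp add: fs_deriv_def)
  have "2 * fubini_study w (fs_christoffel w u v) x =
      fderiv (\<lambda>q. fubini_study q v x) w u + fderiv (\<lambda>q. fubini_study q u x) w v
      - fderiv (\<lambda>q. fubini_study q u v) w x" for x
    unfolding D using fs_christoffel_commute[of w] fubini_study_commute[of w] by simp
  then show ?thesis
    unfolding christoffel_def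
    by (intro the_equality fubini_study_nondegenerate[of w]) (auto, metis mult_left_cancel zero_neq_numeral)
qed

lemma cov_deriv_fubini_study: "cov_deriv fubini_study F V = fs_deriv F V"
  by (simp add: fun_eq_iff cov_deriv_def fs_deriv_def christoffel_fubini_study)

lemma fs_deriv_add:
  assumes "V differentiable (at u)" "W differentiable (at u)"
  shows "fs_deriv F (\<lambda>q. V q + W q) u a = fs_deriv F V u a + fs_deriv F W u a"
  using fderiv_eq[OF has_derivative_add[OF assms[THEN fderiv_has_derivative]]]
  by (simp add: fs_deriv_def fs_christoffel_def fs_phi_linear algebra_simps vector_add_ldistrib vector_sadd_rdistrib)

text \<open>The case c = \<i> says that J is parallel; it rests on \<open>fs_christoffel\<close>
  being complex linear in the field.\<close>

lemma fs_deriv_smult: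
  assumes "V differentiable (at u)"
  shows "fs_deriv F (\<lambda>q. c *s V q) u a = c *s fs_deriv F V u a"
  using fderiv_eq[OF bounded_linear.has_derivative[OF bounded_linear_smult[of c] fderiv_has_derivative[OF assms]]]
  by (simp add: fs_deriv_def fs_christoffel_def fs_phi_linear vec_eq_iff algebra_simps)

text \<open>The second derivative and the Christoffel term are each symmetric. Paired with a normal
  vector, this is the symmetry of the second fundamental form.\<close>

lemma fs_deriv_torsion_free:
  assumes "open S" "smooth_on F S" "u \<in> S"
  shows "fs_deriv F (\<lambda>q. fderiv F q a) u b = fs_deriv F (\<lambda>q. fderiv F q b) u a"
  using smooth_on_second_derivative_symmetric[OF assms, of a b]
  by (simp add: fs_deriv_def fs_christoffel_commute[of "F u" "fderiv F u b"])

text \<open>The curvature tensor on constant coordinate fields, whose bracket vanishes.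
  Antisymmetrizing in a and b cancels the second derivatives and the products of
  \<open>fs_phi\<close> values; the \<open>fs_herm\<close> terms that come from the derivative of
  \<open>fs_phi\<close> remain.\<close>

lemma fs_curvature:
  assumes "open S" "smooth_on F S" "smooth_on V S" "u \<in> S"
  shows "fs_deriv F (\<lambda>q. fs_deriv F V q b) u a - fs_deriv F (\<lambda>q. fs_deriv F V q a) u b =
    (fs_herm (F u) (fderiv F u a) (fderiv F u b) - fs_herm (F u) (fderiv F u b) (fderiv F u a)) *s V u
    + fs_herm (F u) (V u) (fderiv F u b) *s fderiv F u a
    - fs_herm (F u) (V u) (fderiv F u a) *s fderiv F u b"
proof -
  note smult = bounded_bilinear.FDERIV[OF bounded_bilinear_smult]
  note F = smooth_on_has_derivative[OF assms(2,4)] and V = smooth_on_has_derivative[OF assms(3,4)]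
  note F2 = smooth_on_has_derivative[OF smooth_on_fderiv[OF assms(2)] assms(4)]
    and V2 = smooth_on_has_derivative[OF smooth_on_fderiv[OF assms(3)] assms(4)]
  have D: "fderiv (\<lambda>q. fs_deriv F V q b) u a =
    fderiv (\<lambda>q. fderiv V q b) u a
    - (fs_phi (F u) (fderiv F u b) *s fderiv V u a
      + (fs_phi (F u) (fderiv (\<lambda>q. fderiv F q b) u a) + fs_herm (F u) (fderiv F u b) (fderiv F u a)
         - fs_phi (F u) (fderiv F u b) * fs_phi (F u) (fderiv F u a)) *s V u)
    - (fs_phi (F u) (V u) *s fderiv (\<lambda>q. fderiv F q b) u a
      + (fs_phi (F u) (fderiv V u a) + fs_herm (F u) (V u) (fderiv F u a)
         - fs_phi (F u) (V u) * fs_phi (F u) (fderiv F u a)) *s fderiv F u b)" for a b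
    unfolding fs_deriv_def fs_christoffel_def
    by (subst fderiv_eq[OF has_derivative_add[OF V2 has_derivative_minus[OF has_derivative_add[
            OF smult[OF fs_phi_has_derivative[OF F F2] V] smult[OF fs_phi_has_derivative[OF F V] F2]]]]])
       simp
  have neg: "fs_phi w (x - y) = fs_phi w x - fs_phi w y" "fs_phi w (- x) = - fs_phi w x"
    for w x y :: "complex^'b"
    using fs_phi_linear(1)[of w "x - y" y] fs_phi_linear(2)[of w "-1" x]
    by (simp_all add: vector_sneg_minus1[symmetric])
  show ?thesis
    unfolding fs_deriv_def[of F "\<lambda>q. fs_deriv F V q _"] D
      smooth_on_second_derivative_symmetric[OF assms(1,2,4), of a b]
      smooth_on_second_derivative_symmetric[OF assms(1,3,4), of a b]
    by (simp add: fs_deriv_def fs_christoffel_def fs_phi_linear neg vec_eq_iff algebra_simps)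
qed

section \<open>Smoothness of metric and connection along a map, and derivatives of orthogonal
  fields\<close>

lemma smooth_on_fs_phi:
  fixes F V :: "'a::euclidean_space \<Rightarrow> complex^'n"
  assumes "open S" "smooth_on F S" "smooth_on V S"
  shows "smooth_on (\<lambda>u. fs_phi (F u) (V u)) S"
  unfolding fs_phi_def divide_inverse
  by (intro smooth_on_bilinear[OF _ bounded_bilinear_mult] smooth_on_bilinear[OF _ bounded_bilinear_herm]
      smooth_on_inverse smooth_on_add smooth_on_const assms fs_denominator_nonzero)

lemma smooth_on_fubini_study:
  fixes F V W :: "'a::euclidean_space \<Rightarrow> complex^'n"
  assumes "open S" "smooth_on F S" "smooth_on V S" "smooth_on W S"
  shows "smooth_on (\<lambda>u. fubini_study (F u) (V u) (W u)) S"
  unfolding fubini_study_eq fs_herm_def divide_inverse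
  by (intro smooth_on_linear[OF _ bounded_linear_Re] smooth_on_linear[OF _ bounded_linear_cnj]
      smooth_on_bilinear[OF _ bounded_bilinear_mult] smooth_on_bilinear[OF _ bounded_bilinear_herm]
      smooth_on_inverse smooth_on_add smooth_on_diff smooth_on_const smooth_on_fs_phi assms
      fs_denominator_nonzero)

lemma smooth_on_fs_deriv:
  fixes F V :: "'a::euclidean_space \<Rightarrow> complex^'n"
  assumes "open S" "smooth_on F S" "smooth_on V S"
  shows "smooth_on (\<lambda>u. fs_deriv F V u a) S"
proof -
  have "smooth_on (\<lambda>u. fderiv V u a - (fs_phi (F u) (fderiv F u a) *s V u + fs_phi (F u) (V u) *s fderiv F u a)) S"
    by (intro smooth_on_bilinear[OF _ bounded_bilinear_smult] smooth_on_add smooth_on_diff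
        smooth_on_fs_phi smooth_on_fderiv assms)
  then show ?thesis
    by (simp add: fs_deriv_def fs_christoffel_def algebra_simps)
qed

text \<open>Metric compatibility for a product that vanishes identically: the derivative moves to
  the other factor with a sign. For a normal and a tangent field this is the Weingarten
  relation.\<close>

lemma fs_deriv_orthogonal:
  fixes F V W :: "'a::euclidean_space \<Rightarrow> complex^'n"
  assumes "open S" "smooth_on F S" "smooth_on V S" "smooth_on W S" "u \<in> S"
    and "\<And>q. q \<in> S \<Longrightarrow> fubini_study (F q) (V q) (W q) = 0"
  shows "fubini_study (F u) (fs_deriv F V u a) (W u) = - fubini_study (F u) (V u) (fs_deriv F W u a)"
proof -
  have "((\<lambda>q. fubini_study (F q) (V q) (W q)) has_derivative (\<lambda>_. 0)) (at u)"
    by (rule has_derivative_transform_within_open[OF has_derivative_const assms(1,5)]) (simp add: assms(6))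
  moreover note fubini_study_has_derivative[OF assms(2-4)[THEN smooth_on_differentiable[OF _ assms(5)]]]
  ultimately have "(\<lambda>a. fubini_study (F u) (fs_deriv F V u a) (W u) + fubini_study (F u) (V u) (fs_deriv F W u a)) = (\<lambda>_. 0)"
    by (rule has_derivative_unique[symmetric])
  then show ?thesis
    by (metis eq_neg_iff_add_eq_0)
qed


section \<open>Smooth orthogonal projections\<close>

lemma fubini_study_orthogonal_span:
  assumes "\<And>x. x \<in> B \<Longrightarrow> fubini_study w v x = 0" "y \<in> span B"
  shows "fubini_study w v y = 0"
proof -
  have "span B \<subseteq> {x. fubini_study w v x = 0}"
    using assms(1) by (intro span_minimal subspaceI) (auto simp: fubini_study_simps)
  then show ?thesis
    using assms(2) by auto
qed

text \<open>The induction is Gram--Schmidt with the parameter \<open>u\<close>.\<close>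

lemma smooth_orthogonal_projection:
  fixes F :: "'a::euclidean_space \<Rightarrow> complex^'n" and f :: "'i \<Rightarrow> 'a \<Rightarrow> complex^'n"
  assumes "open S" "smooth_on F S" "u0 \<in> S" "finite I"
    and "\<forall>i\<in>I. smooth_on (f i) S"
    and "dim ((\<lambda>i. f i u0) ` I) = card I"
  shows "\<exists>T P. open T \<and> u0 \<in> T \<and> T \<subseteq> S \<and>
    (\<forall>u\<in>T. dim ((\<lambda>i. f i u) ` I) = card I \<and>
      (\<forall>v. (\<forall>x \<in> span ((\<lambda>i. f i u) ` I). fubini_study (F u) (P u v) x = 0) \<and>
        v - P u v \<in> span ((\<lambda>i. f i u) ` I))) \<and>
    (\<forall>V R. open R \<and> R \<subseteq> T \<and> smooth_on V R \<longrightarrow> smooth_on (\<lambda>u. P u (V u)) R)"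
  using assms(4-6)
proof (induction I rule: finite_induct)
  case empty
  show ?case
    using assms(1,3) by (intro exI[of _ S] exI[of _ "\<lambda>u v. v"]) (auto simp: fubini_study_simps)
next
  case (insert b I)
  define B where "B u = (\<lambda>i. f i u) ` I" for u
  have B_insert: "(\<lambda>i. f i u) ` insert b I = Set.insert (f b u) (B u)" for u
    by (simp add: B_def)
  have dim_le: "dim (B u) \<le> card I" for u
    unfolding B_def
    using dim_le_card'[of "(\<lambda>i. f i u) ` I"] card_image_le[OF insert.hyps(1), of "\<lambda>i. f i u"] insert.hyps(1)
    by simp
  \<comment> \<open>By \<open>dim_le\<close>, the full dimension at u0 is possible only if
    \<open>f b u0\<close> is a new direction and the other fields have full rank there.\<close>
  have notin: "f b u0 \<notin> span (B u0)" and dimB: "dim (B u0) = card I"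
    using insert.prems(2)[unfolded B_insert dim_insert] insert.hyps dim_le[of u0]
    by (simp_all split: if_splits)
  obtain T P where TP: "open T \<and> u0 \<in> T \<and> T \<subseteq> S \<and>
    (\<forall>u\<in>T. dim (B u) = card I \<and>
      (\<forall>v. (\<forall>x \<in> span (B u). fubini_study (F u) (P u v) x = 0) \<and> v - P u v \<in> span (B u))) \<and>
    (\<forall>V R. open R \<and> R \<subseteq> T \<and> smooth_on V R \<longrightarrow> smooth_on (\<lambda>u. P u (V u)) R)"
  proof -
    have "\<forall>i\<in>I. smooth_on (f i) S"
      using insert.prems(1) by simp
    from insert.IH[OF this dimB[unfolded B_def], folded B_def] show thesis
      by (elim exE) (rule that)
  qed
  then have T: "open T" "u0 \<in> T" "T \<subseteq> S"
    and dim: "\<And>u. u \<in> T \<Longrightarrow> dim (B u) = card I"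
    and P: "\<And>u v x. u \<in> T \<Longrightarrow> x \<in> span (B u) \<Longrightarrow> fubini_study (F u) (P u v) x = 0"
      "\<And>u v. u \<in> T \<Longrightarrow> v - P u v \<in> span (B u)"
    and sm: "\<And>V R. open R \<Longrightarrow> R \<subseteq> T \<Longrightarrow> smooth_on V R \<Longrightarrow> smooth_on (\<lambda>u. P u (V u)) R"
    by auto
  \<comment> \<open>The part of the new field orthogonal to the old ones. It is nonzero at u0
    because \<open>f b u0\<close> lies outside their span, so \<open>T'\<close> is a neighbourhood
    of u0.\<close>
  define E where "E u = P u (f b u)" for u
  define T' where "T' = {u \<in> T. E u \<noteq> 0}"
  \<comment> \<open>The coefficient of \<open>P u v\<close> along \<open>E u\<close>;
    \<open>P'\<close> removes that component.\<close>
  define c where "c u v = fubini_study (F u) (P u v) (E u) * inverse (fubini_study (F u) (E u) (E u))" for u v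
  define P' where "P' u v = P u v - c u v *\<^sub>R E u" for u v
  have smE: "smooth_on E T"
    unfolding E_def using sm[OF T(1) order_refl] smooth_on_subset[OF _ T(3)] insert.prems(1) by blast
  have T': "open T'" "u0 \<in> T'" "T' \<subseteq> T"
    using continuous_open_preimage[OF smooth_on_continuous[OF smE] T(1), of "- {0}"] P(2)[OF T(2), of "f b u0"]
      notin T(2) by (auto simp: T'_def E_def vimage_def Int_def)
  have E_pos: "fubini_study (F u) (E u) (E u) > 0" if "u \<in> T'" for u
    using that by (intro fubini_study_pos) (simp add: T'_def)
  have fb: "f b u - E u \<in> span (B u)" if "u \<in> T" for u
    using P(2)[OF that] by (simp add: E_def)
  have notin': "f b u \<notin> span (B u)" if "u \<in> T'" for u
  proof
    assume "f b u \<in> span (B u)"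
    moreover have "u \<in> T"
      using that T' by auto
    ultimately have "f b u - (f b u - E u) \<in> span (B u)"
      by (intro span_diff fb)
    then have "fubini_study (F u) (E u) (E u) = 0"
      using P(1)[of u "E u" "f b u"] that T' by (auto simp: E_def)
    with E_pos[OF that] show False
      by simp
  qed
  have "dim ((\<lambda>i. f i u) ` insert b I) = card (insert b I)" if "u \<in> T'" for u
    using notin'[OF that] dim[of u] that T' insert.hyps unfolding B_insert dim_insert by auto
  moreover have "fubini_study (F u) (P' u v) x = 0"
    if u: "u \<in> T'" and x: "x \<in> span ((\<lambda>i. f i u) ` insert b I)" for u v x
  proof (rule fubini_study_orthogonal_span[OF _ x])
    have uT: "u \<in> T"
      using u T' by blast
    have span: "fubini_study (F u) (P' u v) y = 0" if "y \<in> span (B u)" for y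
      using P(1)[OF uT that, of v] P(1)[OF uT that, of "f b u"] by (simp add: P'_def E_def fubini_study_simps)
    have "fubini_study (F u) (P' u v) (E u) = 0"
      using E_pos[OF u] by (simp add: P'_def c_def fubini_study_simps)
    then have "fubini_study (F u) (P' u v) (f b u) = 0"
      using span[OF fb[OF uT]] by (simp add: fubini_study_simps)
    moreover fix y
    assume "y \<in> (\<lambda>i. f i u) ` insert b I"
    ultimately show "fubini_study (F u) (P' u v) y = 0"
      using span[OF span_base] unfolding B_insert by blast
  qed
  moreover have "v - P' u v \<in> span ((\<lambda>i. f i u) ` insert b I)" if "u \<in> T'" for u v
  proof -
    have uT: "u \<in> T"
      using that T' by blast
    have mono: "span (B u) \<subseteq> span (Set.insert (f b u) (B u))"
      by (intro span_mono) auto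
    have "f b u - (f b u - E u) \<in> span (Set.insert (f b u) (B u))"
      by (rule span_diff[OF span_base[OF insertI1] subsetD[OF mono fb[OF uT]]])
    then have "E u \<in> span (Set.insert (f b u) (B u))"
      by simp
    then have "(v - P u v) + c u v *\<^sub>R E u \<in> span (Set.insert (f b u) (B u))"
      using P(2)[OF uT] mono by (intro span_add span_scale) auto
    then show ?thesis
      unfolding B_insert by (simp add: P'_def algebra_simps)
  qed
  moreover have "smooth_on (\<lambda>u. P' u (V u)) R" if R: "open R" "R \<subseteq> T'" and V: "smooth_on V R" for V R
  proof -
    have RT: "R \<subseteq> T" "R \<subseteq> S"
      using R T' T by auto
    note sm' = sm[OF R(1) RT(1) V] smooth_on_subset[OF smE RT(1)] smooth_on_subset[OF assms(2) RT(2)]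
    show ?thesis
      unfolding P'_def c_def
      by (intro smooth_on_diff smooth_on_bilinear[OF _ bounded_bilinear_scaleR]
          smooth_on_bilinear[OF _ bounded_bilinear_mult] smooth_on_inverse smooth_on_fubini_study sm' R(1))
        (use E_pos R in force)
  qed
  ultimately show ?case
    using T' T by (intro exI[of _ T'] exI[of _ P']) auto
qed

text \<open>Two candidates differ by a vector both tangent and normal, hence zero by positive
  definiteness. So any candidate evaluates the definite description.\<close>

lemma normal_part_fubini_study:
  assumes "linear (fderiv F u)" "n \<in> normal_space fubini_study F u" "v - n \<in> tangent_space F u"
  shows "normal_part fubini_study F u v = n"
  unfolding normal_part_def
proof (rule the_equality)
  fix m
  assume m: "m \<in> normal_space fubini_study F u \<and> v - m \<in> tangent_space F u"
  have "(v - n) - (v - m) \<in> tangent_space F u"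
    using assms(3) m subspace_diff[OF linear_subspace_image[OF assms(1) subspace_UNIV]]
    unfolding tangent_space_def by blast
  then have "fubini_study (F u) m (m - n) = 0" "fubini_study (F u) n (m - n) = 0"
    using m assms(2) by (auto simp: normal_space_def)
  then have "fubini_study (F u) (m - n) (m - n) = 0"
    by (simp add: fubini_study_simps)
  then show "m = n"
    using fubini_study_pos[of "m - n" "F u"] by force
qed (use assms in auto)

text \<open>A basis chosen among the \<open>f i u0\<close> stays one near \<open>u0\<close>, because the rank is constant.\<close>

lemma smooth_constant_rank_projection:
  fixes F :: "'a::euclidean_space \<Rightarrow> complex^'n" and f :: "'i \<Rightarrow> 'a \<Rightarrow> complex^'n"
  assumes "open S" "smooth_on F S" "u0 \<in> S" "finite I" "\<forall>i\<in>I. smooth_on (f i) S"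
    and rank: "\<And>u. u \<in> S \<Longrightarrow> dim ((\<lambda>i. f i u) ` I) = r"
  obtains T P where "open T" "u0 \<in> T" "T \<subseteq> S"
    "\<forall>u\<in>T. \<forall>v. \<forall>x\<in>span ((\<lambda>i. f i u) ` I). fubini_study (F u) (P u v) x = 0"
    "\<forall>u\<in>T. \<forall>v. v - P u v \<in> span ((\<lambda>i. f i u) ` I)"
    "\<forall>V R. open R \<and> R \<subseteq> T \<and> smooth_on V R \<longrightarrow> smooth_on (\<lambda>u. P u (V u)) R"
proof -
  obtain B where B: "B \<subseteq> (\<lambda>i. f i u0) ` I" "independent B" "card B = r"
    using basis_exists[of "(\<lambda>i. f i u0) ` I"] rank[OF assms(3)] by metis
  then obtain I' where I': "I' \<subseteq> I" "inj_on (\<lambda>i. f i u0) I'" "B = (\<lambda>i. f i u0) ` I'"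
    by (auto simp: subset_image_inj)
  have card: "dim ((\<lambda>i. f i u0) ` I') = card I'" "card I' = r"
    using B I' by (auto simp: dim_eq_card_independent card_image)
  have "finite I'" "\<forall>i\<in>I'. smooth_on (f i) S"
    using I' assms(4,5) finite_subset by auto
  from smooth_orthogonal_projection[OF assms(1-3) this card(1)] obtain T P where TP:
    "open T \<and> u0 \<in> T \<and> T \<subseteq> S \<and>
    (\<forall>u\<in>T. dim ((\<lambda>i. f i u) ` I') = card I' \<and>
      (\<forall>v. (\<forall>x \<in> span ((\<lambda>i. f i u) ` I'). fubini_study (F u) (P u v) x = 0) \<and>
        v - P u v \<in> span ((\<lambda>i. f i u) ` I'))) \<and>
    (\<forall>V R. open R \<and> R \<subseteq> T \<and> smooth_on V R \<longrightarrow> smooth_on (\<lambda>u. P u (V u)) R)"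
    by (elim exE)
  \<comment> \<open>The selected fields keep their rank on T and the whole family has the same rank,
    so they span the same space at every u in T and the projection serves the whole family.\<close>
  have span: "span ((\<lambda>i. f i u) ` I') = span ((\<lambda>i. f i u) ` I)" if "u \<in> T" for u
  proof (rule dim_eq_span)
    show "(\<lambda>i. f i u) ` I' \<subseteq> (\<lambda>i. f i u) ` I"
      using I'(1) by blast
    have "u \<in> S"
      using that TP by blast
    then show "dim ((\<lambda>i. f i u) ` I) \<le> dim ((\<lambda>i. f i u) ` I')"
      using that TP card(2) rank by simp
  qed
  show thesis
    by (rule that[of T P]) (use TP span in auto)
qed


section \<open>The Ricci equation\<close>

text \<open>Constant fields have zero bracket, so the vanishing of their normal curvature is the
  equality of the two mixed normal derivatives.\<close>

lemma normal_flat_constant_fields: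
  assumes "normal_flat fubini_study F W" "open T" "T \<subseteq> W" "u \<in> T" "smooth_on \<eta> T" "linear (fderiv F u)"
    and "\<And>q. q \<in> T \<Longrightarrow> \<eta> q \<in> normal_space fubini_study F q"
  shows "normal_part fubini_study F u (fs_deriv F (\<lambda>q. normal_part fubini_study F q (fs_deriv F \<eta> q b)) u a) =
    normal_part fubini_study F u (fs_deriv F (\<lambda>q. normal_part fubini_study F q (fs_deriv F \<eta> q a)) u b)"
proof -
  have "normal_curvature fubini_study F (\<lambda>_. a) (\<lambda>_. b) \<eta> u = 0"
    using assms(1-5,7) smooth_on_const[of a T] smooth_on_const[of b T] unfolding normal_flat_def by blast
  moreover have "fs_deriv F \<eta> u 0 = 0"
    using linear_0[OF assms(6)] linear_0[OF has_derivative_linear[OF smooth_on_has_derivative[OF assms(5,4)]]]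
    by (simp add: fs_deriv_def fs_christoffel_def fs_phi_def herm_def vec_eq_iff)
  moreover have "normal_part fubini_study F u 0 = 0"
    using linear_0[OF assms(6)]
    by (intro normal_part_fubini_study[OF assms(6)])
      (auto simp: normal_space_def fubini_study_simps tangent_space_def image_iff intro: exI[of _ 0])
  ultimately show ?thesis
    by (simp add: normal_curvature_def normal_connection_def[abs_def] lie_bracket_def cov_deriv_fubini_study)
qed

text \<open>F is an immersion in coordinates and b represents J applied to the image of a. The
  constant rank r makes T + J T a smooth subbundle, and r below the real ambient dimension leaves it
  a nonzero orthogonal complement, from which \<eta> is taken.\<close>

lemma normal_connection_not_flat:
  fixes F :: "'a::euclidean_space \<Rightarrow> complex^'n"
  assumes W: "open W" "smooth_on F W" "u0 \<in> W"
    and inj: "\<And>u. u \<in> W \<Longrightarrow> inj (fderiv F u)"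
    and rank: "\<And>u. u \<in> W \<Longrightarrow> dim (tangent_space F u \<union> cplx_J ` tangent_space F u) = r"
      "r < 2 * CARD('n)"
    and ab: "fderiv F u0 b = \<i> *s fderiv F u0 a" "fderiv F u0 a \<noteq> 0"
    and flat: "normal_flat fubini_study F W"
  shows False
proof -
  have lin: "linear (fderiv F u)" if "u \<in> W" for u
    using has_derivative_linear[OF smooth_on_has_derivative[OF W(2) that]] .
  have lin_J: "linear (\<lambda>v :: complex^'n. \<i> *s v)"
    by (rule bounded_linear.linear[OF bounded_linear_smult])
  have tangent: "span ((\<lambda>x. fderiv F u x) ` Basis) = tangent_space F u" if "u \<in> W" for u
    using linear_span_image[OF lin[OF that], of Basis] by (simp add: tangent_space_def)
  have dim_tangent: "dim ((\<lambda>x. fderiv F u x) ` Basis) = DIM('a)" if "u \<in> W" for u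
    using dim_image_eq[OF lin[OF that], of Basis] inj[OF that]
    by (metis dim_UNIV dim_span span_Basis inj_on_subset subset_UNIV)
  \<comment> \<open>A spanning family of T + J T with an index set independent of u, as the
    projection lemma requires.\<close>
  define JT where "JT u = (\<lambda>(c, x). c *s fderiv F u x) ` ({1, \<i>} \<times> Basis)" for u
  have JT: "span (JT u) = span (tangent_space F u \<union> cplx_J ` tangent_space F u)" if "u \<in> W" for u
  proof -
    have "JT u = fderiv F u ` Basis \<union> (\<lambda>v. \<i> *s v) ` fderiv F u ` Basis"
      by (auto simp: JT_def image_iff)
    then have "span (JT u) = {x + y | x y. x \<in> span (fderiv F u ` Basis) \<and> y \<in> (\<lambda>v. \<i> *s v) ` span (fderiv F u ` Basis)}"
      by (simp add: span_Un linear_span_image[OF lin_J])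
    also have "\<dots> = {x + y | x y. x \<in> span (tangent_space F u) \<and> y \<in> (\<lambda>v. \<i> *s v) ` span (tangent_space F u)}"
      by (simp add: span_span flip: tangent[OF that])
    also have "\<dots> = span (tangent_space F u \<union> cplx_J ` tangent_space F u)"
      by (simp add: span_Un linear_span_image[OF lin_J] cplx_J_def[abs_def])
    finally show ?thesis .
  qed
  have smF_Basis: "\<forall>i\<in>Basis. smooth_on (\<lambda>u. fderiv F u i) W"
    by (simp add: smooth_on_fderiv W)
  \<comment> \<open>P projects to the normal space; Q, obtained below, projects to the orthogonal
    complement of T + J T.\<close>
  obtain T1 P where T1: "open T1" "u0 \<in> T1" "T1 \<subseteq> W"
    and P': "\<forall>u\<in>T1. \<forall>v. \<forall>x\<in>span ((\<lambda>x. fderiv F u x) ` Basis). fubini_study (F u) (P u v) x = 0"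
      "\<forall>u\<in>T1. \<forall>v. v - P u v \<in> span ((\<lambda>x. fderiv F u x) ` Basis)"
    and smP': "\<forall>V R. open R \<and> R \<subseteq> T1 \<and> smooth_on V R \<longrightarrow> smooth_on (\<lambda>u. P u (V u)) R"
    by (rule smooth_constant_rank_projection[OF W finite_Basis smF_Basis dim_tangent])
  note P = P'(1)[rule_format] P'(2)[rule_format] and smP = smP'[rule_format, OF conjI, OF _ conjI]
  have smJT: "\<forall>i \<in> {1, \<i>} \<times> Basis. smooth_on (\<lambda>u. case i of (c, x) \<Rightarrow> c *s fderiv F u x) W"
    by (auto intro!: smooth_on_linear[OF W(1) bounded_linear_smult] smooth_on_fderiv W)
  have finJT: "finite ({1, \<i>} \<times> (Basis :: 'a set))"
    by simp
  have dimJT: "dim ((\<lambda>i. case i of (c, x) \<Rightarrow> c *s fderiv F u x) ` ({1, \<i>} \<times> Basis)) = r" if "u \<in> W" for u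
    using JT[OF that] rank(1)[OF that] unfolding JT_def by (metis dim_span)
  obtain T2 Q where T2: "open T2" "u0 \<in> T2" "T2 \<subseteq> W"
    and Q': "\<forall>u\<in>T2. \<forall>v. \<forall>x\<in>span (JT u). fubini_study (F u) (Q u v) x = 0"
      "\<forall>u\<in>T2. \<forall>v. v - Q u v \<in> span (JT u)"
    and smQ': "\<forall>V R. open R \<and> R \<subseteq> T2 \<and> smooth_on V R \<longrightarrow> smooth_on (\<lambda>u. Q u (V u)) R"
    unfolding JT_def by (rule smooth_constant_rank_projection[OF W finJT smJT dimJT])
  note Q = Q'(1)[rule_format] Q'(2)[rule_format] and smQ = smQ'[rule_format, OF conjI, OF _ conjI]
  define T where "T = T1 \<inter> T2"
  have T: "open T" "u0 \<in> T" "T \<subseteq> W" "T \<subseteq> T1" "T \<subseteq> T2"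
    using T1 T2 by (auto simp: T_def)
  note F = smooth_on_subset[OF W(2) T(3)]
  have smF: "smooth_on (\<lambda>u. fderiv F u x) T" for x
    by (rule smooth_on_fderiv[OF F])

  have "dim (JT u0) < DIM(complex^'n)"
    using rank(2) dimJT[OF W(3)] by (simp add: JT_def)
  \<comment> \<open>Outside T + J T at u0, so that its projection \<eta> does not vanish
    there.\<close>
  then obtain v0 where v0: "v0 \<notin> span (JT u0)"
    by (metis UNIV_I dim_UNIV dim_span less_irrefl subsetI subset_antisym top_greatest)
  define \<eta> where "\<eta> u = Q u v0" for u
  have sm\<eta>: "smooth_on \<eta> T"
    unfolding \<eta>_def using smQ[OF T(1,5)] smooth_on_const by blast
  have \<eta>0: "\<eta> u0 \<noteq> 0"
    using Q(2)[OF T2(2), of v0] v0 by (auto simp: \<eta>_def)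
  have \<eta>F: "fubini_study (F u) (\<eta> u) (fderiv F u x) = 0" "fubini_study (F u) (\<eta> u) (\<i> *s fderiv F u x) = 0"
    if "u \<in> T" for u x
  proof -
    have u: "u \<in> W" "u \<in> T2"
      using that T by auto
    have "fderiv F u x \<in> span (JT u)" "\<i> *s fderiv F u x \<in> span (JT u)"
      unfolding JT[OF u(1)] by (auto intro!: span_base simp: tangent_space_def cplx_J_def)
    then show "fubini_study (F u) (\<eta> u) (fderiv F u x) = 0"
      "fubini_study (F u) (\<eta> u) (\<i> *s fderiv F u x) = 0"
      unfolding \<eta>_def by (auto intro: Q(1)[OF u(2)])
  qed
  have sm\<zeta>: "smooth_on (\<lambda>u. \<i> *s \<eta> u) T"
    by (rule smooth_on_linear[OF T(1) bounded_linear_smult sm\<eta>])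
  \<comment> \<open>As J is skew, orthogonality of \<eta> to J T makes J \<eta> normal.\<close>
  have \<zeta>F: "fubini_study (F u) (fderiv F u x) (\<i> *s \<eta> u) = 0" if "u \<in> T" for u x
    using \<eta>F(2)[OF that, of x] by (simp add: fubini_study_commute[of _ _ "\<i> *s \<eta> u"] fubini_study_J_left)

  \<comment> \<open>The normal derivative of \<eta> in direction b.\<close>
  define N where "N b q = normal_part fubini_study F q (fs_deriv F \<eta> q b)" for b q
  have PT: "\<And>x. x \<in> tangent_space F u \<Longrightarrow> fubini_study (F u) (P u v) x = 0" "v - P u v \<in> tangent_space F u"
    if "u \<in> T" for u v
    using that T P[of u] tangent[of u] by blast+
  have normal_part: "normal_part fubini_study F u v = P u v" if "u \<in> T" for u v
    using that T PT[OF that] lin[of u]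
    by (intro normal_part_fubini_study) (auto simp: normal_space_def)
  have smN: "smooth_on (N b) T" for b
    by (rule smooth_on_cong[OF T(1) smP[OF T(1,4) smooth_on_fs_deriv[OF T(1) F sm\<eta>]]])
      (simp add: N_def normal_part)
  \<comment> \<open>Minus the tangential part of the derivative of \<eta>, that is, the ambient
    vector of \<open>A_\<eta> b\<close>; s below gives its coordinates.\<close>
  define V where "V b q = N b q - fs_deriv F \<eta> q b" for b q
  have smV: "smooth_on (V b) T" for b
    unfolding V_def by (intro smooth_on_diff smN smooth_on_fs_deriv T F sm\<eta>)
  have "\<exists>s. V b q = fderiv F q s" if q: "q \<in> T" for b q
  proof -
    obtain x where "fs_deriv F \<eta> q b - P q (fs_deriv F \<eta> q b) = fderiv F q x"
      using PT(2)[OF q] unfolding tangent_space_def by blast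
    then have "V b q = fderiv F q (- x)"
      using q T linear_neg[OF lin, of q x] by (auto simp: V_def N_def normal_part algebra_simps)
    then show ?thesis ..
  qed
  then have "\<forall>b q. \<exists>s. q \<in> T \<longrightarrow> V b q = fderiv F q s"
    by blast
  then obtain s where s: "\<And>b q. q \<in> T \<Longrightarrow> V b q = fderiv F q (s b q)"
    by metis
  let ?g = "fubini_study (F u0)"
  let ?s = "\<lambda>b. s b u0" and ?X = "\<lambda>x. fderiv F u0 x" and ?\<zeta> = "\<i> *s \<eta> u0"
  note orth = fs_deriv_orthogonal[OF T(1) F _ _ T(2)]
  note tf = fs_deriv_torsion_free[OF T(1) F T(2)]
  \<comment> \<open>\<open>V b\<close> is exchanged for the field with constant coordinates and the
    same value at u0. Torsion-freeness then swaps the directions, and the parallel J passes from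
    \<eta> to the image of a.\<close>
  have V\<zeta>: "?g (fs_deriv F (V b) u0 a) ?\<zeta> = ?g (\<i> *s ?X a) (fs_deriv F \<eta> u0 (?s b))" for a b
  proof -
    have "?g (fs_deriv F (V b) u0 a) ?\<zeta> = - ?g (V b u0) (fs_deriv F (\<lambda>q. \<i> *s \<eta> q) u0 a)"
      by (rule orth[OF smV sm\<zeta>]) (simp add: s \<zeta>F)
    also have "\<dots> = ?g (fs_deriv F (\<lambda>q. fderiv F q (?s b)) u0 a) ?\<zeta>"
      using orth[OF smF sm\<zeta> \<zeta>F, of "?s b" a] by (simp add: s T)
    also have "\<dots> = ?g (fs_deriv F (\<lambda>q. fderiv F q a) u0 (?s b)) ?\<zeta>"
      by (simp add: tf[of "?s b"])
    also have "\<dots> = - ?g (?X a) (fs_deriv F (\<lambda>q. \<i> *s \<eta> q) u0 (?s b))"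
      by (rule orth[OF smF sm\<zeta> \<zeta>F])
    also have "\<dots> = ?g (\<i> *s ?X a) (fs_deriv F \<eta> u0 (?s b))"
      by (simp add: fs_deriv_smult smooth_on_differentiable[OF sm\<eta> T(2)] fubini_study_J_left)
    finally show ?thesis .
  qed
  have F\<eta>: "fubini_study (F u) (fderiv F u x) (\<eta> u) = 0" if "u \<in> T" for u x
    using \<eta>F(1)[OF that, of x] by (simp add: fubini_study_commute)
  \<comment> \<open>The self-adjointness of \<open>A_\<eta>\<close>: the left side is minus the
    product of \<open>A_\<eta> (A_\<eta> b)\<close> with b.\<close>
  have square: "?g (?X b) (fs_deriv F \<eta> u0 (?s b)) = - ?g (V b u0) (V b u0)" for b
  proof -
    have "?g (?X b) (fs_deriv F \<eta> u0 (?s b)) = - ?g (fs_deriv F (\<lambda>q. fderiv F q b) u0 (?s b)) (\<eta> u0)"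
      using orth[OF smF sm\<eta> F\<eta>, of b "?s b"] by simp
    also have "\<dots> = - ?g (fs_deriv F (\<lambda>q. fderiv F q (?s b)) u0 b) (\<eta> u0)"
      by (simp add: tf[of "?s b"])
    also have "\<dots> = ?g (?X (?s b)) (fs_deriv F \<eta> u0 b)"
      using orth[OF smF sm\<eta> F\<eta>, of "?s b" b] by simp
    also have "\<dots> = ?g (V b u0) (N b u0 - V b u0)"
      by (simp add: s[OF T(2), symmetric]) (simp add: V_def)
    also have "\<dots> = - ?g (V b u0) (V b u0)"
    proof -
      have "?g (N b u0) (V b u0) = 0"
        using PT(1)[OF T(2), of "V b u0"] s[OF T(2), of b] T(2)
        by (simp add: N_def normal_part tangent_space_def)
      then show ?thesis
        by (simp add: fubini_study_simps fubini_study_commute[of "F u0" "V b u0" "N b u0"])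
    qed
    finally show ?thesis .
  qed
  \<comment> \<open>Pairing with the normal vector J \<eta> does not see tangential parts, so
    flatness can be tested on full derivatives.\<close>
  have normal_part_\<zeta>: "?g (normal_part fubini_study F u0 v) ?\<zeta> = ?g v ?\<zeta>" for v
  proof -
    obtain x where "v - P u0 v = ?X x"
      using PT(2)[OF T(2), of v] by (auto simp: tangent_space_def)
    then have "?g (v - P u0 v) ?\<zeta> = 0"
      using \<zeta>F[OF T(2)] by simp
    then show ?thesis
      by (simp add: normal_part T fubini_study_simps)
  qed
  have "normal_part fubini_study F u0 (fs_deriv F (N b) u0 a) =
      normal_part fubini_study F u0 (fs_deriv F (N a) u0 b)"
    unfolding N_def
    using \<eta>F by (intro normal_flat_constant_fields[OF flat T(1,3,2) sm\<eta> lin[OF W(3)]])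
      (auto simp: normal_space_def tangent_space_def)
  then have "?g (fs_deriv F (N b) u0 a) ?\<zeta> = ?g (fs_deriv F (N a) u0 b) ?\<zeta>"
    by (metis normal_part_\<zeta>)
  moreover have "fs_deriv F (N y) u0 x = fs_deriv F (V y) u0 x + fs_deriv F (\<lambda>q. fs_deriv F \<eta> q y) u0 x" for x y
    using fs_deriv_add[OF smV[THEN smooth_on_differentiable[OF _ T(2)]]
        smooth_on_fs_deriv[OF T(1) F sm\<eta>, THEN smooth_on_differentiable[OF _ T(2)]], of F y y x]
    by (simp add: V_def)
  \<comment> \<open>J sends the image of a to that of b, and the image of b to minus that of a;
    hence the opposite signs of this square and the next, which add up after
    antisymmetrization.\<close>
  moreover have "?g (fs_deriv F (V b) u0 a) ?\<zeta> = - ?g (V b u0) (V b u0)"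
    using V\<zeta>[of b a] square[of b] by (simp add: ab)
  moreover have "?g (fs_deriv F (V a) u0 b) ?\<zeta> = ?g (V a u0) (V a u0)"
    using V\<zeta>[of a b] square[of a] by (simp add: ab vector_smult_assoc fubini_study_simps vector_sneg_minus1[symmetric])
  ultimately have "?g (fs_deriv F (\<lambda>q. fs_deriv F \<eta> q b) u0 a - fs_deriv F (\<lambda>q. fs_deriv F \<eta> q a) u0 b) ?\<zeta>
      = ?g (V a u0) (V a u0) + ?g (V b u0) (V b u0)"
    by (simp add: fubini_study_simps)
  moreover have "?g v v \<ge> 0" for v
    using fubini_study_pos[of v "F u0"] by (cases "v = 0") (auto simp: fubini_study_simps)
  ultimately have "?g (fs_deriv F (\<lambda>q. fs_deriv F \<eta> q b) u0 a - fs_deriv F (\<lambda>q. fs_deriv F \<eta> q a) u0 b) ?\<zeta> \<ge> 0"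
    by simp
  \<comment> \<open>Real and imaginary parts vanish by orthogonality to T and J T. Only the first
    term of the curvature formula survives, with coefficient
    \<open>cnj \<i> - \<i> = - 2 * \<i>\<close> times the square of the image of a; pairing it with
    J \<eta> gives a negative number.\<close>
  moreover have "fs_herm (F u0) (\<eta> u0) (?X x) = 0" for x
    using \<eta>F[OF T(2), of x] by (simp add: fubini_study_eq fs_herm_sesquilinear complex_eq_iff)
  moreover have real: "fs_herm (F u0) v v = complex_of_real (?g v v)" for v
    using fs_herm_sesquilinear(5)[of "F u0" v v] by (simp add: fubini_study_eq complex_eq_iff)
  ultimately have "?g (((- 2 * \<i>) * complex_of_real (?g (?X a) (?X a))) *s \<eta> u0) ?\<zeta> \<ge> 0"
    unfolding fs_curvature[OF T(1) F sm\<eta> T(2)] ab(1) fs_herm_sesquilinear(3,4)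
    by (simp add: algebra_simps)
  then have "?g (?X a) (?X a) * ?g (\<eta> u0) (\<eta> u0) \<le> 0"
    unfolding fubini_study_eq[of _ "_ *s _"] fs_herm_sesquilinear(3,4) real by (simp add: mult.commute)
  moreover have "?g (?X a) (?X a) * ?g (\<eta> u0) (\<eta> u0) > 0"
    by (intro mult_pos_pos fubini_study_pos ab \<eta>0)
  ultimately show False
    by simp
qed

section \<open>Passage from the manifold to one pair of charts\<close>

theorem theorem1p3:
  fixes A :: "('m, real^3) chart set" and \<iota> :: "'m \<Rightarrow> 'n::finite cproj" and p :: nat
  assumes "p > 1"
    and "2 * CARD('n) = 3 + p"
    and "smooth_manifold A" and "carrier A \<noteq> {}"
    and "immersion A cproj_atlas \<iota>"
    and "maximal_CR_dimension3 A \<iota>"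
    and "flat_normal_connection A \<iota>"
  shows "p = 3 \<and> (\<forall>x\<in>carrier A. distinguished_normal_umbilical A \<iota> x)"
proof -
  have sm: "smooth_map A cproj_atlas \<iota>"
    using assms(5) by (simp add: immersion_def)
  obtain x c where c: "c \<in> A" "x \<in> fst c"
    using assms(4) by (auto simp: carrier_def)
  then have "\<iota> x \<in> carrier cproj_atlas"
    using sm unfolding smooth_map_def carrier_def by blast
  then obtain d where d: "d \<in> cproj_atlas" "\<iota> x \<in> fst d"
    by (auto simp: carrier_def)
  define F where "F = coord_rep c d \<iota>"
  define W where "W = coord_dom c d \<iota>"
  have W: "open W" "smooth_on F W" "snd c x \<in> W"
    using sm c d by (auto simp: smooth_map_def F_def W_def coord_dom_def)
  have inj: "inj (fderiv F u)" if "u \<in> W" for u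
    using assms(5) that c d by (auto simp: immersion_def F_def W_def)
  have H: "dim (holomorphic_tangent_space F u) = 2" if "u \<in> W" for u
    using assms(6) that c d by (auto simp: maximal_CR_dimension3_def F_def W_def)
  have lin: "linear (fderiv F u)" if "u \<in> W" for u
    using has_derivative_linear[OF smooth_on_has_derivative[OF W(2) that]] .
  have lin_J: "linear (cplx_J :: complex^'n \<Rightarrow> _)"
    unfolding cplx_J_def[abs_def] by (rule bounded_linear.linear[OF bounded_linear_smult])
  have inj_J: "inj (cplx_J :: complex^'n \<Rightarrow> _)"
    by (auto intro!: injI simp: cplx_J_def)
  \<comment> \<open>The dimension is 3 + 3 - 2, since T and J T meet in the holomorphic tangent
    space.\<close>
  have rank: "dim (tangent_space F u \<union> cplx_J ` tangent_space F u) = 4" if "u \<in> W" for u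
  proof -
    have sub: "subspace (tangent_space F u)"
      unfolding tangent_space_def by (rule linear_subspace_image[OF lin[OF that] subspace_UNIV])
    have dim: "dim (tangent_space F u) = 3"
      unfolding tangent_space_def using dim_image_eq[OF lin[OF that], of UNIV] inj[OF that] by simp
    have "dim (cplx_J ` tangent_space F u) = 3"
      using dim_image_eq[OF lin_J inj_on_subset[OF inj_J subset_UNIV]] dim by simp
    then have "dim {x + y |x y. x \<in> tangent_space F u \<and> y \<in> cplx_J ` tangent_space F u} = 4"
      using dim_sums_Int[OF sub linear_subspace_image[OF lin_J sub]] dim H[OF that]
      by (simp add: holomorphic_tangent_space_def Int_commute)
    moreover have "span (tangent_space F u \<union> cplx_J ` tangent_space F u) =
        {x + y |x y. x \<in> tangent_space F u \<and> y \<in> cplx_J ` tangent_space F u}"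
      unfolding span_Un span_eq_iff[THEN iffD2, OF sub]
        span_eq_iff[THEN iffD2, OF linear_subspace_image[OF lin_J sub]] ..
    ultimately show ?thesis
      by (metis dim_span)
  qed
  \<comment> \<open>A nonzero vector of this space is tangent and also J of a tangent vector, which
    provides the pair X, J X.\<close>
  have "\<not> holomorphic_tangent_space F (snd c x) \<subseteq> {0}"
    using H[OF W(3)] by (metis dim_eq_0 zero_neq_numeral)
  then obtain w where w: "w \<in> holomorphic_tangent_space F (snd c x)" "w \<noteq> 0"
    by blast
  then obtain a b where "w = \<i> *s fderiv F (snd c x) a" "w = fderiv F (snd c x) b"
    unfolding holomorphic_tangent_space_def tangent_space_def cplx_J_def by blast
  then have ab: "fderiv F (snd c x) b = \<i> *s fderiv F (snd c x) a" "fderiv F (snd c x) a \<noteq> 0"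
    using w(2) by auto
  \<comment> \<open>The real ambient dimension 3 + p exceeds the rank 4 of T + J T because p >
    1.\<close>
  have "4 < 2 * CARD('n)"
    using assms(1,2) by simp
  moreover have "normal_flat fubini_study F W"
    using assms(7) c d by (auto simp: flat_normal_connection_def F_def W_def)
  ultimately have False
    using normal_connection_not_flat[OF W inj rank _ ab] by blast
  then show ?thesis ..
qed

end
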